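(* Let $X\subset\mathbb{C}$ be a nondegenerate non-separating continuum, and let $h:\mathrm{Bd}(X)\times[0,1]\to\mathbb{C}$ be an isotopy, $h^t=h(\cdot,t)$, with $h^0=\mathrm{id}_{\mathrm{Bd}(X)}$. For each $t$ let $U^t$ be the unbounded component of $\mathbb{C}\setminus h^t(\mathrm{Bd}(X))$. If $x\in \mathrm{Bd}(X)$ is accessible from $U=\mathbb{C}\setminus X$, then $h^t(x)$ is accessible from $U^t$ for each $t\in[0,1]$.
   Context: A continuum is a compact connected set; $X\subset\mathbb{C}$ is non-separating if $\mathbb{C}\setminus X$ is connected. An isotopy is a continuous map $h:\mathrm{Bd}(X)\times[0,1]\to\mathbb{C}$ such that each $h^t$ is a homeomorphism onto its image. $\mathbb{D}$ is the open unit disk, $O$ the origin and $\mathbb{C}^*=\mathbb{C}\cup\{\infty\}$. Accessible: let $V$ be the complement in $\mathbb{C}$ of a nondegenerate non-separating continuum $Y$ (here $Y=\mathbb{C}\setminus U^t$), and let $\varphi:\mathbb{D}\to V\cup\{\infty\}$ be the conformal isomorphism with $\varphi(O)=\infty$ and $\varphi'(O)>0$ (i.e. $\lim_{z\to0}z\varphi(z)>0$). For an angle $\theta$ the external ray is $R_\theta=\varphi(\{re^{i\theta}:0\le r<1\})$; it lands on $y$ if $\overline{R_\theta}\setminus R_\theta=\{y\}$ (closure in $\mathbb{C}^*$). A point $y\in Y$ is accessible from $V$ if some external ray $R_\theta$ lands on $y$. *)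

theory Defs
  imports "HOL-Complex_Analysis.Complex_Analysis"
begin

definition continuum :: "complex set \<Rightarrow> bool" where
  "continuum X \<longleftrightarrow> compact X \<and> connected X"

definition nondegenerate :: "'a set \<Rightarrow> bool" where
  "nondegenerate X \<longleftrightarrow> (\<exists>a\<in>X. \<exists>b\<in>X. a \<noteq> b)"

definition non_separating :: "complex set \<Rightarrow> bool" where
  "non_separating X \<longleftrightarrow> connected (- X)"

definition isotopy_on :: "complex set \<Rightarrow> (complex \<times> real \<Rightarrow> complex) \<Rightarrow> bool" where
  "isotopy_on S h \<longleftrightarrow>
     continuous_on (S \<times> {0..1}) h \<and>
     (\<forall>t\<in>{0..1}. \<exists>g. homeomorphism S ((\<lambda>x. h (x, t)) ` S) (\<lambda>x. h (x, t)) g)"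

text \<open>The extended plane: \<open>None\<close> is the point at infinity, \<open>Some z\<close> the finite point \<open>z\<close>.\<close>

definition riemann_sphere :: "complex option topology" where
  "riemann_sphere = Alexandroff_compactification euclidean"

text \<open>The two charts \<open>w\<close> and \<open>1/w\<close> of the sphere. Their values at \<open>None\<close>, respectively at
  \<open>Some 0\<close>, are junk; they are never used below, because continuity keeps a map near the
  point at which the chart is chosen.\<close>

definition finite_chart :: "complex option \<Rightarrow> complex" where
  "finite_chart p = (case p of None \<Rightarrow> 0 | Some w \<Rightarrow> w)"

definition infinity_chart :: "complex option \<Rightarrow> complex" where
  "infinity_chart p = (case p of None \<Rightarrow> 0 | Some w \<Rightarrow> inverse w)"

definition sphere_holomorphic_on :: "(complex \<Rightarrow> complex option) \<Rightarrow> complex set \<Rightarrow> bool" where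
  "sphere_holomorphic_on \<phi> D \<longleftrightarrow>
     continuous_map (top_of_set D) riemann_sphere \<phi> \<and>
     (\<forall>z\<in>D. if \<phi> z = None then (infinity_chart \<circ> \<phi>) analytic_on {z}
                           else (finite_chart \<circ> \<phi>) analytic_on {z})"

text \<open>A bijective holomorphic map between Riemann surfaces has a holomorphic inverse, so
  bijectivity and holomorphy suffice for a conformal isomorphism.\<close>

definition conformal_iso :: "(complex \<Rightarrow> complex option) \<Rightarrow> complex set \<Rightarrow> complex option set \<Rightarrow> bool" where
  "conformal_iso \<phi> D W \<longleftrightarrow> sphere_holomorphic_on \<phi> D \<and> bij_betw \<phi> D W"

text \<open>The last conjunct is the normalization \<open>\<phi>'(0) > 0\<close>, i.e. \<open>z * \<phi> z\<close> tends to a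
  positive real as \<open>z\<close> tends to \<open>0\<close>.\<close>

definition exterior_riemann_map :: "complex set \<Rightarrow> (complex \<Rightarrow> complex option) \<Rightarrow> bool" where
  "exterior_riemann_map V \<phi> \<longleftrightarrow>
     conformal_iso \<phi> (ball 0 1) (insert None (Some ` V)) \<and>
     \<phi> 0 = None \<and>
     (\<exists>c::real. c > 0 \<and> ((\<lambda>z. z * finite_chart (\<phi> z)) \<longlongrightarrow> complex_of_real c) (at 0))"

definition external_ray :: "(complex \<Rightarrow> complex option) \<Rightarrow> real \<Rightarrow> complex option set" where
  "external_ray \<phi> \<theta> = \<phi> ` {complex_of_real r * cis \<theta> | r. 0 \<le> r \<and> r < 1}"

definition lands_on :: "complex option set \<Rightarrow> complex \<Rightarrow> bool" where
  "lands_on R y \<longleftrightarrow> (riemann_sphere closure_of R) - R = {Some y}"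

text \<open>The normalized map \<open>\<phi>\<close> is unique on the disk, so the existential over \<open>\<phi>\<close> only names it;
  it exists exactly when the complement of \<open>V\<close> is a nondegenerate non-separating continuum,
  so that precondition is not repeated here.\<close>

definition accessible_from :: "complex set \<Rightarrow> complex \<Rightarrow> bool" where
  "accessible_from V y \<longleftrightarrow>
     y \<notin> V \<and> (\<exists>\<phi> \<theta>. exterior_riemann_map V \<phi> \<and> lands_on (external_ray \<phi> \<theta>) y)"

end

theory Submission
  imports Defs
begin

text \<open>
  Accessibility of a point \<open>p\<close> of a plane continuum \<open>K\<close> can be read off from a purely topological
  property that an isotopy cannot destroy: \<^emph>\<open>\<open>p\<close> is accessible from the unbounded complementary
  domain if and only if \<open>z - p\<close> has a continuous logarithm on \<open>K - {p}\<close>.\<close>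

  If a ray lands on \<open>x\<close>, then the ray together with \<open>x\<close> is a closed connected unbounded set, so
  each component of its complement is simply connected and carries a logarithm of \<open>z - x\<close>
  (\<open>accessible_imp_logarithm\<close>). An isotopy \<open>h\<close> moves \<open>z - x\<close> through nonvanishing functions
  \<open>h (z, t) - h (x, t)\<close> on \<open>frontier X - {x}\<close>, so the logarithm can be lifted along the covering
  \<open>exp\<close> up to every time \<open>t\<close> (\<open>isotopy_transports_logarithm\<close>).

  The converse (\<open>logarithm_imp_accessible\<close>) is the main work. Pass to the coordinate
  \<open>w = 1 / (z - p)\<close>, which puts \<open>p\<close> at infinity and \<open>\<infinity>\<close> at the origin. Now \<open>K\<close> becomes a closed set
  \<open>K'\<close> on which \<open>w\<close> has a logarithm. Extending the logarithm to the plane by Tietze's theorem, one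
  finds a closed set \<open>F\<close> that contains \<open>0\<close> and misses \<open>K'\<close> such that \<open>w\<close> has a logarithm off \<open>F\<close>. The
  component of \<open>F\<close> at \<open>0\<close> must be unbounded, for otherwise a compact set around it, disjoint from \<open>F\<close>,
  would separate \<open>0\<close> from infinity and still carry a logarithm
  (\<open>logarithm_imp_unbounded_connected_avoiding\<close>). This connected set lies in the inverted domain \<open>V\<close>,
  and it yields a decreasing sequence of subdomains of \<open>V\<close> that escapes to infinity.

  Let \<open>\<psi>\<close> map the disk conformally onto \<open>V\<close>. The preimages of the subdomains accumulate at a common
  boundary point \<open>\<zeta>\<close>, and \<open>\<psi>\<close> is uniformly large on them. A Lindeloef type argument then gives
  \<open>\<psi> (r * \<zeta>) \<rightarrow> \<infinity>\<close> as \<open>r \<rightarrow> 1\<close> (\<open>univalent_radial_limit_infinity\<close>). It needs no curve ending at \<open>\<zeta>\<close>: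
  it is enough that \<open>\<zeta>\<close> belongs to the closure of each preimage. Undoing the inversion, the
  normalized exterior map is \<open>p + 1 / \<psi>\<close>, and its ray in the direction of \<open>\<zeta>\<close> lands on \<open>p\<close>.
\<close>

section \<open>Logarithms and complementary components in the plane\<close>

text \<open>A logarithm of \<open>z - a\<close> deforms the direction map of \<open>S\<close> as seen from \<open>a\<close> to a constant, which by
  Borsuk's criterion is possible only if \<open>a\<close> is not enclosed by \<open>S\<close>.\<close>

lemma no_logarithm_around_bounded_component:
  fixes a :: complex
  assumes "compact S" "a \<notin> S" "bounded (connected_component_set (- S) a)"
    and cont: "continuous_on S l" and l: "\<And>z. z \<in> S \<Longrightarrow> exp (l z) = z - a"
  shows False
proof -
  have "inverse (norm (z - a)) *\<^sub>R (z - a) = exp (\<i> * of_real (Im (l z)))" if "z \<in> S" for z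
  proof -
    have "z - a = of_real (norm (z - a)) * exp (\<i> * of_real (Im (l z)))"
      using l[OF that] by (metis exp_eq_polar norm_exp_eq_Re cis_conv_exp)
    moreover have "z \<noteq> a" using that assms(2) by auto
    ultimately show ?thesis
      by (metis (no_types, opaque_lifting) eq_iff_diff_eq_0 left_inverse norm_eq_zero of_real_eq_0_iff 
          of_real_inverse mult.assoc mult.left_neutral scaleR_conv_of_real)
  qed
  moreover have "continuous_on S (\<lambda>z. Im (l z))"
    by (intro continuous_intros cont)
  ultimately have "\<exists>c. homotopic_with_canon (\<lambda>x. True) S (sphere 0 1)
      (\<lambda>z. inverse (norm (z - a)) *\<^sub>R (z - a)) (\<lambda>x. c)"
    unfolding inessential_eq_continuous_logarithm_circle by blast
  then show False
    using Borsuk_map_essential_bounded_component[OF assms(1,2)] assms(3) by blast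
qed

lemma closed_diff_openin:
  fixes F :: "complex set"
  assumes "closed F" "openin (top_of_set F) A"
  shows "closed (F - A)"
proof -
  obtain G where "open G" "A = F \<inter> G" using assms(2) openin_open by blast
  moreover have "F - F \<inter> G = F - G" by blast
  ultimately show ?thesis using assms(1) by (simp add: closed_Diff)
qed

text \<open>The Sura-Bura theorem: components of a locally compact set need not be open in it, but a compact
  one has arbitrarily small compact open neighbourhoods. Such a set can be split off with a positive
  distance to the rest.\<close>

lemma bounded_component_imp_compact_clopen:
  fixes F :: "complex set"
  assumes "closed F" "a \<in> F" "bounded (connected_component_set F a)"
  obtains A B where "compact A" "closed B" "A \<inter> B = {}" "A \<union> B = F" "a \<in> A"
     "openin (top_of_set F) A"
proof -
  have "closed (connected_component_set F a)"
    using assms(1) by (simp add: closed_connected_component)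
  with assms have "compact (connected_component_set F a)"
    by (simp add: compact_eq_bounded_closed)
  moreover have "connected_component_set F a \<in> components F"
    using assms(2) by (simp add: componentsI)
  ultimately obtain K where K: "openin (top_of_set F) K" "compact K" "connected_component_set F a \<subseteq> K"
    using Sura_Bura_clopen_subset[of F _ UNIV] assms(1) closed_imp_locally_compact
    by (metis open_UNIV subset_UNIV)
  show ?thesis
  proof
    show "closed (F - K)" using closed_diff_openin K assms(1) by blast
    show "K \<union> (F - K) = F" using K(1) openin_imp_subset by blast
    show "a \<in> K" using K(3) assms(2) by (meson connected_component_refl mem_Collect_eq subsetD)
  qed (use K in auto)
qed

text \<open>If the component of \<open>a\<close> were bounded, a level set of the distance to a split-off compact piece of
  \<open>F\<close> would be a compact set that misses \<open>F\<close> and encloses \<open>a\<close>.\<close>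

lemma logarithm_imp_unbounded_component:
  fixes F :: "complex set"
  assumes "closed F" "a \<in> F"
    and cont: "continuous_on (- F) l" and l: "\<And>z. z \<notin> F \<Longrightarrow> exp (l z) = z - a"
  shows "\<not> bounded (connected_component_set F a)"
proof
  assume "bounded (connected_component_set F a)"
  then obtain A B where AB: "compact A" "closed B" "A \<inter> B = {}" "A \<union> B = F" "a \<in> A"
    using bounded_component_imp_compact_clopen assms by metis
  obtain d where d: "d > 0" "\<And>x y. x \<in> A \<Longrightarrow> y \<in> B \<Longrightarrow> d \<le> dist x y"
    using separate_compact_closed[OF AB(1,2,3)] by blast
  define N where "N = {z. infdist z A < d/2}"
  define S where "S = {z. infdist z A = d/2}"
  have bN: "bounded N"
  proof -
    obtain R where R: "\<And>x. x \<in> A \<Longrightarrow> norm x \<le> R"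
      using compact_imp_bounded[OF AB(1)] by (auto simp: bounded_iff)
    have "norm z \<le> R + d" if "infdist z A \<le> d/2" for z
    proof -
      obtain x where x: "x \<in> A" "infdist z A = dist z x"
        using infdist_attains_inf[of A z] AB compact_imp_closed by blast
      have "norm z \<le> norm x + dist z x" by norm
      with R[OF x(1)] x that d show ?thesis by simp
    qed
    then show ?thesis unfolding N_def bounded_iff by (metis less_imp_le mem_Collect_eq)
  qed
  have clN: "closure N \<subseteq> {z. infdist z A \<le> d/2}"
    by (rule closure_minimal) (auto simp: N_def intro!: closed_Collect_le continuous_intros)
  have frN: "frontier N \<subseteq> S"
  proof -
    have "open N" unfolding N_def by (intro open_Collect_less continuous_intros)
    then have "frontier N \<subseteq> closure N - N" by (simp add: frontier_def interior_open)
    then have "infdist z A \<le> d/2" "\<not> infdist z A < d/2" if "z \<in> frontier N" for z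
      using clN that by (auto simp: N_def)
    then show ?thesis by (force simp: S_def)
  qed
  \<comment> \<open>This frontier encloses \<open>a\<close>, misses \<open>F\<close>, and so carries the forbidden logarithm.\<close>
  let ?T = "frontier N"
  have T: "?T \<inter> F = {}"
  proof -
    have "z \<notin> A" if "z \<in> S" for z using that d by (auto simp: S_def)
    moreover have "z \<notin> B" if "z \<in> S" for z
    proof
      assume "z \<in> B"
      obtain x where x: "x \<in> A" "infdist z A = dist z x"
        using infdist_attains_inf[of A z] AB compact_imp_closed by blast
      then show False using that d(1) d(2)[OF x(1) \<open>z \<in> B\<close>] by (simp add: S_def dist_commute)
    qed
    ultimately show ?thesis using frN AB by blast
  qed
  have "a \<in> N" using AB(5) d by (simp add: N_def)
  have "connected_component_set (- ?T) a \<subseteq> N"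
  proof (rule ccontr)
    assume "\<not> ?thesis"
    then have "connected_component_set (- ?T) a \<inter> frontier N \<noteq> {}"
    proof (intro connected_Int_frontier)
      have "a \<in> connected_component_set (- ?T) a"
        using T assms(2) by (auto intro!: connected_component_refl)
      then show "connected_component_set (- ?T) a \<inter> N \<noteq> {}" using \<open>a \<in> N\<close> by blast
    qed (use \<open>\<not> connected_component_set (- ?T) a \<subseteq> N\<close> in auto)
    then show False using connected_component_subset by fastforce
  qed
  then have "bounded (connected_component_set (- ?T) a)" using bN bounded_subset by blast
  moreover have "compact ?T" using bN by (simp add: compact_frontier_bounded)
  moreover have "a \<notin> ?T" using T assms(2) by auto
  moreover have "continuous_on ?T l" using cont T by (metis continuous_on_subset disjoint_eq_subset_Compl)
  ultimately show False
    using no_logarithm_around_bounded_component[of ?T a l] l T by blast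
qed

text \<open>The complement of a component of \<open>- S\<close> is connected and contains the unbounded set \<open>S\<close>; hence all
  components of \<open>- S\<close> are simply connected, and \<open>z - x\<close> does not vanish on them.\<close>

lemma logarithm_off_unbounded_connected:
  fixes S :: "complex set"
  assumes "closed S" "connected S" "\<not> bounded S" "x \<in> S"
  obtains l where "continuous_on (- S) l" "\<And>z. z \<notin> S \<Longrightarrow> exp (l z) = z - x"
proof -
  have "simply_connected C" if C: "C \<in> components (- S)" for C
  proof -
    have "open C" using C assms(1) by (meson open_components open_Compl)
    moreover have "connected (- C)" using component_complement_connected assms(2) C by blast
    moreover have "S \<subseteq> - C" using C in_components_subset by blast
    moreover have "connected C" using C in_components_connected by blast
    moreover have "\<not> bounded (- C)" using assms(3) bounded_subset[of "- C" S, OF _ \<open>S \<subseteq> - C\<close>] by iprover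
    moreover have "components (- C) = {- C}"
      using \<open>connected (- C)\<close> assms(4) \<open>S \<subseteq> - C\<close> by (auto simp: components_eq_sing_iff)
    ultimately show ?thesis
      by (simp add: simply_connected_eq_unbounded_complement_components)
  qed
  then have "Borsukian (- S)"
    using assms(1) by (simp add: Borsukian_eq_simply_connected open_Compl)
  moreover have "continuous_on (- S) (\<lambda>z. z - x)" "(\<lambda>z. z - x) \<in> (- S) \<rightarrow> - {0}"
    using assms(4) by (auto intro!: continuous_intros)
  ultimately obtain l where "continuous_on (- S) l" "\<forall>z \<in> - S. z - x = exp (l z)"
    unfolding Borsukian_continuous_logarithm by (elim allE[of _ "\<lambda>z. z - x"]) blast
  then show ?thesis using that by auto
qed

text \<open>The continuum \<open>E \<union> {\<infinity>}\<close> is approached at infinity by connected pieces of \<open>E\<close> itself: if every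
  component of \<open>E - ball 0 R\<close> were compact, finitely many compact open pieces would absorb the part
  near the circle \<open>|z| = R\<close>, and the remaining unbounded part of \<open>E\<close> would be open and closed in \<open>E\<close>.\<close>

lemma unbounded_connected_tail:
  fixes E :: "complex set"
  assumes "closed E" "connected E" "\<not> bounded E"
  obtains E' where "E' \<subseteq> E - ball 0 R" "closed E'" "connected E'" "\<not> bounded E'"
proof -
  define T where "T = E - ball 0 R"
  have clT: "closed T" using assms(1) by (simp add: T_def closed_Diff)
  have "\<exists>a\<in>T. \<not> bounded (connected_component_set T a)"
  proof (rule ccontr)
    assume "\<not> ?thesis"
    then have "\<forall>a\<in>T. \<exists>A. compact A \<and> a \<in> A \<and> openin (top_of_set T) A"
      using bounded_component_imp_compact_clopen[OF clT] by metis
    then obtain A where A0: "\<forall>a\<in>T. compact (A a) \<and> a \<in> A a \<and> openin (top_of_set T) (A a)"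
      using bchoice[of T "\<lambda>a A. compact A \<and> a \<in> A \<and> openin (top_of_set T) A"] by blast
    then have A: "\<And>a. a \<in> T \<Longrightarrow> compact (A a)" "\<And>a. a \<in> T \<Longrightarrow> a \<in> A a"
       "\<And>a. a \<in> T \<Longrightarrow> openin (top_of_set T) (A a)" by blast+
    have cT: "compact (T \<inter> cball 0 R)" using clT by (simp add: closed_Int_compact)
    have "\<forall>a\<in>T. \<exists>G. open G \<and> A a = T \<inter> G"
      using A(3) unfolding openin_open by blast
    then obtain G where G: "\<forall>a\<in>T. open (G a) \<and> A a = T \<inter> G a"
      using bchoice[of T "\<lambda>a G. open G \<and> A a = T \<inter> G"] by blast
    have cov: "T \<inter> cball 0 R \<subseteq> (\<Union>a\<in>T \<inter> cball 0 R. G a)" using G A(2) by blast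
    have "\<And>a. a \<in> T \<inter> cball 0 R \<Longrightarrow> open (G a)" using G by blast
    from compactE_image[OF cT this cov]
    obtain D where D: "D \<subseteq> T \<inter> cball 0 R" "finite D" "T \<inter> cball 0 R \<subseteq> (\<Union>a\<in>D. G a)"
      by metis
    then have "T \<inter> cball 0 R \<subseteq> (\<Union>a\<in>D. A a)" using G by blast
    note D = D(1,2) this
    define P where "P = (\<Union>a\<in>D. A a)"
    have P: "compact P" "openin (top_of_set T) P"
      unfolding P_def using A D by (blast intro!: compact_UN, blast)
    have cl: "closed (T - P)" using closed_diff_openin clT P by blast
    have "P \<union> (E \<inter> cball 0 R) \<union> (T - P) = E" using P(2) openin_imp_subset[OF P(2)] by (auto simp: T_def)
    moreover have "closed (P \<union> (E \<inter> cball 0 R))" using P(1) assms(1) by (auto intro: compact_imp_closed)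
    moreover have "(P \<union> (E \<inter> cball 0 R)) \<inter> (T - P) = {}" using D(3) by (auto simp: P_def)
    moreover have "T - P \<noteq> {}" 
    proof
      assume "T - P = {}"
      then have "E = P \<union> (E \<inter> cball 0 R)" using calculation(1) by blast
      moreover have "bounded (P \<union> (E \<inter> cball 0 R))" 
        using compact_imp_bounded[OF P(1)] by (simp add: bounded_Int)
      ultimately have "bounded E" by simp
      then show False using assms(3) by simp
    qed
    ultimately have emp: "P \<union> (E \<inter> cball 0 R) = {}"
      using connected_closedD[OF assms(2) _ _ _ cl, of "P \<union> (E \<inter> cball 0 R)"] by blast
    then have "E = T" using openin_imp_subset[OF P(2)] by (auto simp: T_def)
    then obtain a where "a \<in> T" using assms(3) by fastforce
    moreover have "connected_component_set T a = T"
      using \<open>E = T\<close> assms(2) \<open>a \<in> T\<close> by (metis connected_component_eq_self)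
    ultimately show False using \<open>\<not> (\<exists>a\<in>T. \<not> bounded (connected_component_set T a))\<close> assms(3) \<open>E = T\<close> by metis
  qed
  then obtain a where a: "a \<in> T" "\<not> bounded (connected_component_set T a)" by blast
  show ?thesis
    by (rule that[of "connected_component_set T a"])
       (use a clT connected_component_subset[of T a] in \<open>auto simp: T_def closed_connected_component\<close>)
qed

section \<open>Unbounded connected sets avoiding a set with a logarithm\<close>

text \<open>Let \<open>m\<close> extend the logarithm to the whole plane, and let \<open>F\<close> be the set where \<open>w * exp (- m w)\<close> lies on
  the nonpositive real axis. This quotient is 1 on \<open>K\<close>, so \<open>F\<close> misses \<open>K\<close>, and off \<open>F\<close> its
  principal logarithm plus \<open>m\<close> is a logarithm of \<open>w\<close>.\<close>

lemma logarithm_imp_unbounded_connected_avoiding: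
  fixes K :: "complex set"
  assumes "closed K" "continuous_on K l" "\<And>w. w \<in> K \<Longrightarrow> exp (l w) = w"
  obtains E where "closed E" "connected E" "\<not> bounded E" "0 \<in> E" "E \<inter> K = {}"
proof -
  obtain m where m: "continuous_on UNIV m" "\<And>w. w \<in> K \<Longrightarrow> m w = l w"
    using Tietze_unbounded[OF assms(2), of UNIV] assms(1) by auto
  define g where "g = (\<lambda>w. w * exp (- m w))"
  have contg: "continuous_on A g" for A
    unfolding g_def using m(1) by (intro continuous_intros) (auto elim: continuous_on_subset)
  define F where "F = g -` \<real>\<^sub>\<le>\<^sub>0"
  have "closed F" unfolding F_def
    by (rule closed_vimage[OF closed_nonpos_Reals_complex contg])
  have gK: "g w = 1" if "w \<in> K" for w
  proof -
    have "g w = exp (l w) * exp (- l w)" using assms(3)[OF that] m(2)[OF that] by (simp add: g_def)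
    then show ?thesis by (simp flip: exp_add)
  qed
  have "F \<inter> K = {}" using gK by (auto simp: F_def)
  have "0 \<in> F" by (simp add: F_def g_def)
  define n where "n = (\<lambda>w. Ln (g w) + m w)"
  have "continuous_on (- F) n" unfolding n_def
    using m(1) by (intro continuous_intros contg) (auto simp: F_def elim: continuous_on_subset)
  moreover have "exp (n w) = w - 0" if "w \<notin> F" for w
  proof -
    have "g w \<noteq> 0" using that by (auto simp: F_def)
    then have "exp (n w) = g w * exp (m w)" by (simp add: n_def exp_add)
    also have "\<dots> = w * (exp (- m w) * exp (m w))" by (simp add: g_def)
    finally show ?thesis by (simp flip: exp_add)
  qed
  ultimately have "\<not> bounded (connected_component_set F 0)"
    using logarithm_imp_unbounded_component \<open>closed F\<close> \<open>0 \<in> F\<close> by blast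
  show ?thesis
  proof
    show "closed (connected_component_set F 0)" using \<open>closed F\<close> by (rule closed_connected_component)
    show "0 \<in> connected_component_set F 0" using \<open>0 \<in> F\<close> by simp
    show "connected_component_set F 0 \<inter> K = {}"
      using connected_component_subset[of F 0] \<open>F \<inter> K = {}\<close> by blast
  qed (fact | simp)+
qed

text \<open>Iterating \<open>unbounded_connected_tail\<close> gives nested tails of \<open>E\<close>; the domains are the components around
  them of the part of \<open>V\<close> outside growing disks.\<close>

lemma unbounded_connected_imp_escaping_domains:
  fixes V :: "complex set"
  assumes "open V" "E \<subseteq> V" "closed E" "connected E" "\<not> bounded E"
  obtains N :: "nat \<Rightarrow> complex set" where
    "\<And>n. open (N n)" "\<And>n. connected (N n)" "\<And>n. N n \<noteq> {}" "\<And>n. N n \<subseteq> V" "decseq N"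
    "\<And>n w. w \<in> N n \<Longrightarrow> real n \<le> norm w"
proof -
  have "\<exists>T. \<forall>n. (closed (T n) \<and> connected (T n) \<and> \<not> bounded (T n) \<and> T n \<subseteq> E - ball 0 (real n))
        \<and> T (Suc n) \<subseteq> T n"
  proof (rule dependent_nat_choice)
    obtain E' where "E' \<subseteq> E - ball 0 0" "closed E'" "connected E'" "\<not> bounded E'"
      using unbounded_connected_tail[OF assms(3,4,5)] by metis
    then show "\<exists>x. closed x \<and> connected x \<and> \<not> bounded x \<and> x \<subseteq> E - ball 0 (real 0)"
      by auto
  next
    fix x n assume x: "closed x \<and> connected x \<and> \<not> bounded x \<and> x \<subseteq> E - ball 0 (real n)"
    then obtain E' where "E' \<subseteq> x - ball 0 (real (Suc n))" "closed E'" "connected E'" "\<not> bounded E'"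
      using unbounded_connected_tail[of x] by metis
    with x show "\<exists>y. (closed y \<and> connected y \<and> \<not> bounded y \<and> y \<subseteq> E - ball 0 (real (Suc n))) \<and> y \<subseteq> x"
      by (intro exI[of _ E']) auto
  qed
  then obtain T where T: "\<And>n. connected (T n)" "\<And>n. \<not> bounded (T n)" "\<And>n. T n \<subseteq> E - ball 0 (real n)"
    "\<And>n. T (Suc n) \<subseteq> T n" by blast
  define G where "G = (\<lambda>n::nat. V \<inter> - cball 0 (real n))"
  have TG: "T (Suc n) \<subseteq> G n" for n using T(3)[of "Suc n"] assms(2) by (auto simp: G_def)
  have "T (Suc n) \<noteq> {}" for n using T(2)[of "Suc n"] by auto
  moreover define e where "e = (\<lambda>n. SOME w. w \<in> T (Suc n))"
  ultimately have e: "e n \<in> T (Suc n)" for n by (simp add: some_in_eq)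
  \<comment> \<open>The shift to \<open>T (Suc n)\<close> puts the tail strictly outside the closed disk of radius \<open>n\<close>,
    so that the surrounding set is open.\<close>
  define N where "N = (\<lambda>n. connected_component_set (G n) (e n))"
  have TN: "T (Suc n) \<subseteq> N n" for n
    unfolding N_def using e T(1) TG by (intro connected_component_maximal) auto
  show ?thesis
  proof
    fix n
    show "open (N n)" unfolding N_def G_def using assms(1)
      by (intro open_connected_component open_Int) (auto simp: open_Compl)
    show "connected (N n)" by (simp add: N_def)
    show "N n \<noteq> {}" using TN e by blast
    have "N n \<subseteq> G n" by (simp add: N_def connected_component_subset)
    then show "N n \<subseteq> V" and "\<And>w. w \<in> N n \<Longrightarrow> real n \<le> norm w" by (auto simp: G_def)
  next
    show "decseq N"
    proof (rule decseq_SucI)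
      fix n
      have "N (Suc n) \<subseteq> G n"
        using connected_component_subset[of "G (Suc n)"] by (fastforce simp: N_def G_def)
      moreover have "e (Suc n) \<in> N (Suc n)" using TN e by blast
      moreover have "e (Suc n) \<in> N n" using TN e T(4) by blast
      ultimately have "N (Suc n) \<subseteq> connected_component_set (G n) (e (Suc n))"
        by (intro connected_component_maximal) (auto simp: N_def)
      also have "\<dots> = N n" using \<open>e (Suc n) \<in> N n\<close> connected_component_eq unfolding N_def by blast
      finally show "N (Suc n) \<le> N n" by simp
    qed
  qed
qed


section \<open>Radial limits of univalent functions\<close>

text \<open>A Borsuk-Ulam argument. If the origin were not enclosed, there would be a continuous argument
  \<open>u\<close> on \<open>Q \<union> - Q\<close>. The difference \<open>u z - u (- z)\<close> is an odd multiple of \<open>\<pi>\<close>, hence a nonzero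
  constant on the connected set \<open>Q\<close>; but it changes sign between \<open>a\<close> and \<open>- a\<close>.\<close>

lemma antipodal_connected_union_encloses_origin:
  fixes Q :: "complex set"
  assumes "compact Q" "connected Q" "0 \<notin> Q" "a \<in> Q" "- a \<in> Q"
  shows "bounded (connected_component_set (- (Q \<union> uminus ` Q)) 0)"
proof (rule ccontr)
  define E where "E = Q \<union> uminus ` Q"
  assume "\<not> ?thesis"
  moreover have "compact E" unfolding E_def
    using assms(1) by (intro compact_Un compact_continuous_image continuous_intros)
  moreover have "0 \<notin> E" using assms(3) by (auto simp: E_def)
  ultimately have "\<exists>c. homotopic_with_canon (\<lambda>x. True) E (sphere 0 1)
      (\<lambda>z. inverse (norm (z - 0)) *\<^sub>R (z - 0)) (\<lambda>x. c)"
    using Borsuk_map_essential_bounded_component[of E 0] unfolding E_def by blast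
  then obtain u where u: "continuous_on E u" "\<And>z. z \<in> E \<Longrightarrow> inverse (norm z) *\<^sub>R z = exp (\<i> * of_real (u z))"
    unfolding inessential_eq_continuous_logarithm_circle by auto
  define d where "d = (\<lambda>z. u z - u (- z))"
  have ed: "exp (\<i> * of_real (d z)) = -1" if "z \<in> Q" for z
  proof -
    have z: "z \<in> E" "- z \<in> E" "z \<noteq> 0" using that assms(3) by (auto simp: E_def)
    have "exp (\<i> * of_real (d z)) = exp (\<i> * of_real (u z)) / exp (\<i> * of_real (u (- z)))"
      by (simp add: d_def algebra_simps exp_diff)
    moreover have "exp (\<i> * of_real (u (- z))) = - exp (\<i> * of_real (u z))"
      using u(2)[OF z(1)] u(2)[OF z(2)] by simp
    ultimately have "exp (\<i> * of_real (d z)) = exp (\<i> * of_real (u z)) / - exp (\<i> * of_real (u z))"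
      by simp
    also have "\<dots> = -1" by simp
    finally show ?thesis .
  qed
  have "continuous_on Q d"
    unfolding d_def by (intro continuous_intros continuous_on_subset[OF u(1)]
        continuous_on_compose2[OF u(1), of Q uminus]) (auto simp: E_def)
  moreover have "\<exists>e>0. \<forall>y. y \<in> Q \<and> d y \<noteq> d x \<longrightarrow> e \<le> norm (d y - d x)" if "x \<in> Q" for x
  proof (intro exI[of _ "2 * pi"] conjI allI impI)
    fix y assume y: "y \<in> Q \<and> d y \<noteq> d x"
    have "exp (\<i> * of_real (d y)) = exp (\<i> * of_real (d x))" using ed y that by simp
    then obtain n :: int where "\<i> * of_real (d y) = \<i> * of_real (d x) + (2 * of_int n * pi) * \<i>"
      by (auto simp: exp_eq)
    then have "\<i> * complex_of_real (d y) = \<i> * of_real (d x + 2 * of_int n * pi)"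
      by (simp add: algebra_simps)
    then have n: "d y = d x + 2 * of_int n * pi"
      using of_real_eq_iff by (metis complex_i_not_zero mult_left_cancel)
    with y have "n \<noteq> 0" by auto
    then have "1 \<le> \<bar>real_of_int n\<bar>" by linarith
    then show "2 * pi \<le> norm (d y - d x)" using n by (simp add: abs_mult)
  qed simp
  ultimately have "d constant_on Q"
    using continuous_discrete_range_constant[OF assms(2)] by blast
  then have "d a = d (- a)" using assms(4,5) by (auto simp: constant_on_def)
  then have "d a = 0" by (simp add: d_def)
  then show False using ed[OF assms(4)] by simp
qed

lemma bounded_component_of_compact_subset_ball:
  fixes E :: "complex set"
  assumes "E \<subseteq> ball 0 1" "bounded (connected_component_set (- E) 0)"
  shows "connected_component_set (- E) 0 \<subseteq> ball 0 1"
proof (rule ccontr)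
  assume "\<not> ?thesis"
  then obtain w where w: "connected_component (- E) 0 w" "w \<in> - ball 0 1" by blast
  have "connected (- ball (0::complex) 1)" 
    by (rule connected_complement_bounded_convex) auto
  then have "- ball 0 1 \<subseteq> connected_component_set (- E) w"
    using assms(1) w by (intro connected_component_maximal) auto
  also have "\<dots> = connected_component_set (- E) 0"
    using w(1) connected_component_eq by blast
  finally have "bounded (- ball (0::complex) 1)" using assms(2) bounded_subset by blast
  then show False by (metis bounded_ball bounded_Un Compl_partition not_bounded_UNIV)
qed

lemma power_le_all_imp_le:
  fixes x e :: real
  assumes "0 < e" "\<And>m. x ^ m \<le> C * e ^ m"
  shows "x \<le> e"
proof (rule ccontr)
  assume "\<not> x \<le> e"
  then have "1 < x / e" using assms(1) by simp
  then obtain m where "C < (x / e) ^ m" using real_arch_pow by blast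
  then show False using assms(2)[of m] assms(1) by (simp add: power_divide field_simps)
qed

text \<open>The maximum principle applied to a symmetrized function. Multiply \<open>g\<close> with its reflections in the
  real axis and in the origin to get \<open>h\<close>, which is small wherever one of the four reflections of the
  point lies in \<open>J\<close>. A path in \<open>J\<close> from the imaginary axis to a point near \<open>1\<close>, its reflections, and
  short vertical segments near \<open>1\<close> and \<open>- 1\<close> that join them enclose the origin. On those segments
  \<open>h\<close> is merely bounded by 1, but the factor \<open>(1 - z) * (1 + z)\<close> is small there. Raising \<open>h\<close> to high
  powers makes the price of this factor disappear.\<close>

lemma bounded_holomorphic_small_at_centre:
  fixes g :: "complex \<Rightarrow> complex"
  assumes holg: "g holomorphic_on ball 0 1" and g1: "\<And>z. norm z < 1 \<Longrightarrow> norm (g z) \<le> 1"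
    and J: "open J" "connected J" "J \<subseteq> ball 0 1" "1 \<in> closure J" "b \<in> J" "Re b \<le> 0"
    and e: "0 < e" "\<And>z. z \<in> J \<Longrightarrow> norm (g z) \<le> e"
  shows "norm (g 0) ^ 4 \<le> e"
proof (cases "0 \<in> J")
  case True
  then have "norm (g 0) ^ 4 \<le> norm (g 0) ^ 1" using g1[of 0] by (intro power_decreasing) auto
  also have "\<dots> \<le> e" using e True by simp
  finally show ?thesis .
next
  case False
  define h where "h = (\<lambda>z. g z * cnj (g (cnj z)) * (g (- z) * cnj (g (cnj (- z)))))"
  have holh: "h holomorphic_on ball 0 1"
  proof -
    have c: "(\<lambda>z. cnj (g (cnj z))) holomorphic_on ball 0 1"
    proof -
      have "cnj ` ball 0 1 = (ball 0 1 :: complex set)"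
        by (auto simp: image_cnj_conv_vimage_cnj)
      then have "(cnj \<circ> g \<circ> cnj) holomorphic_on ball 0 1"
        using holg by (subst holomorphic_on_compose_cnj_cnj) auto
      then show ?thesis by (simp add: o_def)
    qed
    have m: "(\<lambda>z. f (- z)) holomorphic_on ball 0 1" if "f holomorphic_on ball 0 1" for f :: "complex \<Rightarrow> complex"
    proof -
      have "(f \<circ> uminus) holomorphic_on ball 0 1"
        by (rule holomorphic_on_compose_gen[OF _ that]) (auto intro!: holomorphic_intros)
      then show ?thesis by (simp add: o_def)
    qed
    show ?thesis unfolding h_def
      by (intro holomorphic_on_mult holg c m[OF holg] m[OF c])
  qed
  have prod1: "norm (h z) \<le> 1" if "norm z < 1" for z
    using that g1 by (auto simp: h_def norm_mult intro!: mult_le_one mult_nonneg_nonneg)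
  have small: "norm (h z) \<le> e" if "norm z < 1" "z \<in> J \<or> cnj z \<in> J \<or> - z \<in> J \<or> cnj (- z) \<in> J" for z
  proof -
    have *: "x1 * x2 * (x3 * x4) \<le> e"
      if "0 \<le> x1" "x1 \<le> 1" "0 \<le> x2" "x2 \<le> 1" "0 \<le> x3" "x3 \<le> 1" "0 \<le> x4" "x4 \<le> 1"
        "x1 \<le> e \<or> x2 \<le> e \<or> x3 \<le> e \<or> x4 \<le> e" for x1 x2 x3 x4 :: real
    proof -
      have "x1 * x2 \<le> x1" "x1 * x2 \<le> x2" "x3 * x4 \<le> x3" "x3 * x4 \<le> x4" "0 \<le> x1 * x2" "0 \<le> x3 * x4"
        using that by (auto simp: mult_left_le mult_right_le_one_le mult_left_le_one_le)
      moreover from this have "x1 * x2 * (x3 * x4) \<le> x1 * x2" "x1 * x2 * (x3 * x4) \<le> x3 * x4"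
        using that by (auto intro!: mult_left_le mult_left_le_one_le)
      ultimately show ?thesis using that(9) by linarith
    qed
    show ?thesis unfolding h_def norm_mult
      by (rule *) (use that g1 e(2) in \<open>auto\<close>)
  qed
  have main: "norm (h 0) ^ m \<le> 2 * e ^ m" for m
  proof (rule field_le_epsilon)
    fix d0 :: real assume "0 < d0"
    define d where "d = d0 / 2"
    have "d > 0" using \<open>0 < d0\<close> by (simp add: d_def)
    obtain a where a: "a \<in> J" "Re a = 0"
    proof -
      obtain b' where b': "b' \<in> J" "dist b' 1 < 1"
        using J(4) by (metis closure_approachable zero_less_one)
      then have "0 < Re b'" using abs_Re_le_cmod[of "b' - 1"] by (auto simp: dist_norm)
      then have "\<exists>z\<in>J. z \<bullet> 1 = 0"
        using connected_ivt_hyperplane[OF J(2), of b b' 1 0] b' J(5,6) by (auto simp: inner_complex_def)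
      then show ?thesis using that by (auto simp: inner_complex_def)
    qed
    obtain q where q: "q \<in> J" "dist q 1 < min d 1"
      using J(4) \<open>d > 0\<close> by (metis closure_approachable zero_less_one min_less_iff_conj)
    have "path_connected J" using J(1,2) connected_open_path_connected by blast
    then obtain \<gamma> where \<gamma>: "path \<gamma>" "path_image \<gamma> \<subseteq> J" "pathstart \<gamma> = a" "pathfinish \<gamma> = q"
      using a q unfolding path_connected_def by blast
    define P where "P = path_image \<gamma>"
    have P: "compact P" "connected P" "P \<subseteq> J" "a \<in> P" "q \<in> P"
      using \<gamma> pathstart_in_path_image[of \<gamma>] pathfinish_in_path_image[of \<gamma>]
      by (auto simp: P_def compact_path_image connected_path_image)
    define Q where "Q = P \<union> closed_segment q (cnj q) \<union> cnj ` P"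
    have seg: "dist z 1 < d \<and> z \<in> ball 0 1 \<and> z \<noteq> 0" if "z \<in> closed_segment q (cnj q)" for z
    proof -
      have "dist (cnj q) 1 = dist q 1" unfolding dist_norm
        by (metis complex_cnj_diff complex_cnj_one complex_mod_cnj)
      then have "closed_segment q (cnj q) \<subseteq> ball 1 (min d 1)"
        using q by (intro closed_segment_subset) (auto simp: dist_commute)
      moreover have "closed_segment q (cnj q) \<subseteq> ball 0 1"
        using q J(3) by (intro closed_segment_subset) auto
      ultimately show ?thesis using that by (force simp: dist_commute)
    qed
    have Qc: "compact Q" unfolding Q_def using P(1)
      by (intro compact_Un compact_continuous_image compact_segment continuous_intros)
    \<comment> \<open>The segment from \<open>q\<close> to its conjugate links the path to its mirror image, which makes \<open>Q\<close>
      connected although the path stops short of the boundary point \<open>1\<close>.\<close>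
    have Qcon: "connected Q"
    proof -
      have "connected (cnj ` P)" using P(2) by (intro connected_continuous_image continuous_intros)
      moreover have "q \<in> P \<inter> closed_segment q (cnj q)" "cnj q \<in> (P \<union> closed_segment q (cnj q)) \<inter> cnj ` P"
        using P(5) by auto
      ultimately show ?thesis unfolding Q_def
        by (metis P(2) connected_Un connected_segment empty_iff)
    qed
    have Qb: "Q \<subseteq> ball 0 1" using P(3) J(3) seg by (auto simp: Q_def)
    have Q0: "0 \<notin> Q" using P(3) False seg by (auto simp: Q_def)
    \<comment> \<open>On the imaginary axis conjugation is the antipodal map, so \<open>Q\<close> contains an antipodal pair.\<close>
    have "cnj a = - a" using a(2) by (simp add: complex_eq_iff)
    then have aQ: "a \<in> Q" "- a \<in> Q" using P(4) by (auto simp: Q_def image_iff intro: bexI[of _ a])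
    define E where "E = Q \<union> uminus ` Q"
    have Eb: "E \<subseteq> ball 0 1" using Qb by (auto simp: E_def)
    have "compact E" unfolding E_def
      using Qc by (intro compact_Un compact_continuous_image continuous_intros)
    have E0: "0 \<notin> E" using Q0 by (auto simp: E_def)
    define W where "W = connected_component_set (- E) 0"
    have Wb: "bounded W" unfolding W_def E_def
      by (rule antipodal_connected_union_encloses_origin) fact+
    have W1: "W \<subseteq> ball 0 1" using bounded_component_of_compact_subset_ball[OF Eb] Wb by (simp add: W_def)
    have "open W" unfolding W_def using \<open>compact E\<close>
      by (simp add: open_connected_component compact_imp_closed open_Compl)
    have fr: "frontier W \<subseteq> E"
      using frontier_of_connected_component_subset[of "- E" 0] frontier_subset_closed[of E] \<open>compact E\<close>
      unfolding W_def by (auto simp: compact_imp_closed)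
    have clW: "closure W \<subseteq> ball 0 1"
      using W1 fr Eb \<open>open W\<close> by (auto simp: frontier_def interior_open)
    define H where "H = (\<lambda>z. h z ^ m * ((1 - z) * (1 + z)))"
    have holH: "H holomorphic_on ball 0 1" unfolding H_def by (intro holomorphic_intros holh)
    have bd: "norm (H z) \<le> 2 * e ^ m + d0" if zE: "z \<in> E" for z
    proof -
      have z1: "norm z < 1" using zE Eb by auto
      have n1: "norm ((1 - z) * (1 + z)) \<le> 2"
      proof -
        have "(1 - z) * (1 + z) = 1 - z^2" by (simp add: power2_eq_square algebra_simps)
        moreover have "norm (1 - z^2) \<le> 1 + norm z ^ 2" using norm_triangle_ineq4[of 1 "z^2"] by (simp add: norm_power)
        moreover have "norm z ^ 2 \<le> 1" using z1 by (simp add: power_le_one)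
        ultimately show ?thesis by simp
      qed
      consider "z \<in> J \<or> cnj z \<in> J \<or> - z \<in> J \<or> cnj (- z) \<in> J"
        | "z \<in> closed_segment q (cnj q) \<or> - z \<in> closed_segment q (cnj q)"
      proof -
        have "y \<in> J \<or> cnj y \<in> J \<or> y \<in> closed_segment q (cnj q)" if "y \<in> Q" for y
          using that P(3) by (auto simp: Q_def)
        moreover have "z \<in> Q \<or> - z \<in> Q" using zE by (auto simp: E_def)
        ultimately show thesis using that by blast
      qed
      then show ?thesis
      proof cases
        case 1
        then have "norm (h z) ^ m \<le> e ^ m" using small[OF z1] by (intro power_mono) auto
        then have "norm (H z) \<le> e ^ m * 2" unfolding H_def norm_mult[of "h z ^ m"] norm_power
          using n1 e(1) by (intro mult_mono) auto
        then show ?thesis using \<open>0 < d0\<close> by simp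
      next
        case 2
        have "norm (1 - z) * norm (1 + z) \<le> d * 2"
        proof -
          have le2: "norm (1 - z) \<le> 2" "norm (1 + z) \<le> 2"
            using norm_triangle_ineq4[of 1 z] norm_triangle_ineq[of 1 z] z1 by auto
          from 2 have "norm (1 - z) \<le> d \<or> norm (1 + z) \<le> d"
            using seg[of z] seg[of "- z"] by (auto simp: dist_norm norm_minus_commute)
          then show ?thesis
          proof
            assume "norm (1 - z) \<le> d" then show ?thesis using le2 \<open>d > 0\<close> by (intro mult_mono) auto
          next
            assume "norm (1 + z) \<le> d"
            then have "norm (1 - z) * norm (1 + z) \<le> 2 * d" using le2 \<open>d > 0\<close> by (intro mult_mono) auto
            then show ?thesis by simp
          qed
        qed
        moreover have "norm (h z) ^ m \<le> 1" using prod1[OF z1] by (simp add: power_le_one)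
        ultimately have "norm (H z) \<le> 1 * (d * 2)" 
          unfolding H_def norm_mult norm_power using mult_mono[of "norm (h z) ^ m" 1 "norm (1 - z) * norm (1 + z)" "d * 2"]
          by simp
        then show ?thesis using zero_less_power[OF e(1), of m] by (simp add: d_def)
      qed
    qed
    have "norm (H 0) \<le> 2 * e ^ m + d0"
    proof (rule maximum_modulus_frontier[of H W])
      show "H holomorphic_on interior W" using holH W1 \<open>open W\<close> by (metis holomorphic_on_subset interior_open)
      show "continuous_on (closure W) H"
        using holH clW holomorphic_on_imp_continuous_on continuous_on_subset by blast
      show "0 \<in> W" using E0 by (simp add: W_def)
    qed (use Wb bd fr in auto)
    then show "norm (h 0) ^ m \<le> 2 * e ^ m + d0" by (simp add: H_def norm_power)
  qed
  have "norm (h 0) \<le> e" using power_le_all_imp_le[OF e(1) main] .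
  moreover have "norm (h 0) = norm (g 0) ^ 4" by (simp add: h_def norm_mult power4_eq_xxxx)
  ultimately show ?thesis by simp
qed

text \<open>A disk automorphism that fixes \<open>1\<close> and \<open>- 1\<close> and moves \<open>r\<close> to the centre reduces this to the
  previous lemma. As \<open>r \<rightarrow> 1\<close>, it pushes any given point of \<open>J\<close> towards \<open>- 1\<close>, so that the moved
  domain eventually meets the left half-plane.\<close>

lemma bounded_holomorphic_small_on_radius:
  fixes g :: "complex \<Rightarrow> complex"
  assumes holg: "g holomorphic_on ball 0 1" and g1: "\<And>z. norm z < 1 \<Longrightarrow> norm (g z) \<le> 1"
    and J: "open J" "connected J" "J \<subseteq> ball 0 1" "1 \<in> closure J"
    and e: "0 < e" "\<And>z. z \<in> J \<Longrightarrow> norm (g z) \<le> e"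
  shows "\<forall>\<^sub>F r in at_left (1::real). norm (g (of_real r)) ^ 4 \<le> e"
proof -
  obtain b where b: "b \<in> J" using J(4) by fastforce
  define M where "M = (\<lambda>r z. (z + of_real r) / (1 + of_real r * z) :: complex)"
  have nz: "1 + of_real r * z \<noteq> 0" if "\<bar>r\<bar> < 1" "norm z \<le> 1" for r :: real and z :: complex
  proof
    assume "1 + of_real r * z = 0"
    then have "norm (of_real r * z) = 1" by (metis add_eq_0_iff norm_minus_cancel norm_one)
    moreover have "norm (of_real r * z) \<le> \<bar>r\<bar> * 1" unfolding norm_mult using that by (intro mult_mono) auto
    ultimately show False using that by simp
  qed
  have Mb: "norm (M r z) < 1" if "\<bar>r\<bar> < 1" "norm z < 1" for r z
  proof -
    have "norm (z + of_real r) < norm (1 + of_real r * z)"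
    proof -
      have "norm (1 + of_real r * z)^2 - norm (z + of_real r)^2 = (1 - r^2) * (1 - norm z ^ 2)"
        unfolding cmod_power2 by (simp add: power2_eq_square algebra_simps)
      moreover have "r^2 < 1" "norm z ^ 2 < 1" using that by (auto simp: abs_square_less_1)
      ultimately have "norm (z + of_real r)^2 < norm (1 + of_real r * z)^2"
        by (smt (verit) mult_pos_pos)
      then show ?thesis by (simp add: power2_less_imp_less)
    qed
    then show ?thesis by (simp add: M_def norm_divide divide_simps)
  qed
  have Minv: "M r (M (- r) z) = z" if "\<bar>r\<bar> < 1" "norm z < 1" for r z
  proof -
    have "1 - of_real r * z \<noteq> 0" using nz[of "- r" z] that by simp
    moreover have "1 - of_real r * of_real r \<noteq> (0::complex)"
    proof -
      have "r^2 < 1" using that by (simp add: abs_square_less_1)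
      then have "1 - r * r \<noteq> 0" by (simp add: power2_eq_square)
      then show ?thesis by (metis of_real_1 of_real_diff of_real_eq_0_iff of_real_mult)
    qed
    moreover have "(z - of_real r) / d + of_real r = z * (1 - of_real r * of_real r) / d"
      "1 + of_real r * ((z - of_real r) / d) = (1 - of_real r * of_real r) / d"
      if "d = 1 - of_real r * z" "d \<noteq> 0" for d
    proof -
      have "(z - of_real r) / d + of_real r = (z - of_real r + of_real r * d) / d"
        "1 + of_real r * ((z - of_real r) / d) = (d + of_real r * (z - of_real r)) / d"
        using that(2) by (simp_all add: add_divide_distrib)
      then show "(z - of_real r) / d + of_real r = z * (1 - of_real r * of_real r) / d"
        "1 + of_real r * ((z - of_real r) / d) = (1 - of_real r * of_real r) / d"
        by (simp_all add: that(1) algebra_simps)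
    qed
    ultimately show ?thesis by (simp add: M_def)
  qed
  have holM: "M r holomorphic_on ball 0 1" if "\<bar>r\<bar> < 1" for r
    unfolding M_def using nz[OF that] by (intro holomorphic_intros) auto
  have "((\<lambda>r::real. Re (M (- r) b)) \<longlongrightarrow> -1) (at_left 1)"
  proof -
    have "b \<noteq> 1" using b J(3) by auto
    have "((\<lambda>r::real. Re ((b + of_real (- r)) / (1 + of_real (- r) * b))) \<longlongrightarrow> 
       Re ((b + of_real (- 1)) / (1 + of_real (- 1) * b))) (at_left 1)"
      using \<open>b \<noteq> 1\<close> by (intro tendsto_intros) auto
    moreover have "(b + of_real (- 1)) / (1 + of_real (- 1) * b) = -1"
      using \<open>b \<noteq> 1\<close> by (simp add: divide_simps)
    ultimately show ?thesis by (simp add: M_def)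
  qed
  then have "\<forall>\<^sub>F r in at_left (1::real). Re (M (- r) b) < 0"
    by (rule order_tendstoD) simp
  moreover have "\<forall>\<^sub>F r in at_left (1::real). r \<in> {0<..<1}"
    by (rule eventually_at_left_real) simp
  ultimately show ?thesis
  proof eventually_elim
    case (elim r)
    then have r: "\<bar>r\<bar> < 1" by auto
    define J' where "J' = M (- r) ` J"
    have J'eq: "J' = {z \<in> ball 0 1. M r z \<in> J}"
    proof -
      have "z \<in> J'" if "norm z < 1" "M r z \<in> J" for z
        using that Minv[of "- r" z] r unfolding J'_def by (metis abs_minus image_eqI minus_minus)
      moreover have "norm (M (- r) z) < 1 \<and> M r (M (- r) z) \<in> J" if "z \<in> J" for z
        using Minv[OF r, of z] Mb[of "- r" z] that J(3) r by auto
      ultimately show ?thesis unfolding J'_def by auto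
    qed
    have "norm ((g \<circ> M r) 0) ^ 4 \<le> e"
    proof (rule bounded_holomorphic_small_at_centre)
      show "g \<circ> M r holomorphic_on ball 0 1"
        using holM[OF r] holg Mb[OF r] by (intro holomorphic_on_compose_gen[of _ _ _ "ball 0 1"]) auto
      show "norm ((g \<circ> M r) z) \<le> 1" if "norm z < 1" for z
        using g1 Mb[OF r that] by simp
      show "open J'"
      proof -
        have "open (ball 0 1 \<inter> M r -` J)"
          using holM[OF r] J(1) by (intro continuous_open_preimage holomorphic_on_imp_continuous_on) auto
        then show ?thesis unfolding J'eq by (simp add: vimage_def Int_def)
      qed
      have cM: "continuous_on (cball 0 1) (M (- r))"
        unfolding M_def using nz[of "- r"] r by (intro continuous_intros) auto
      then show "connected J'" unfolding J'_def
        using J(2,3) by (intro connected_continuous_image) (auto elim!: continuous_on_subset)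
      show "J' \<subseteq> ball 0 1" unfolding J'eq by auto
      show "1 \<in> closure J'"
      proof -
        have "closure J \<subseteq> cball 0 1" using J(3) by (metis ball_subset_cball closed_cball closure_minimal order_trans)
        then have "M (- r) ` closure J \<subseteq> closure J'"
          unfolding J'_def using cM
          by (intro image_closure_subset) (auto elim!: continuous_on_subset closure_subset[THEN subsetD])
        moreover have "M (- r) 1 = 1" using r by (simp add: M_def divide_simps)
        ultimately show ?thesis using J(4) by (metis image_eqI subsetD)
      qed
      show "M (- r) b \<in> J'" using b by (simp add: J'_def)
      show "Re (M (- r) b) \<le> 0" using elim by simp
      show "norm ((g \<circ> M r) z) \<le> e" if "z \<in> J'" for z using that e(2) by (simp add: J'eq)
    qed (use e in auto)
    then show ?case by (simp add: M_def)
  qed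
qed

text \<open>The preceding lemma needs a bounded function, and univalence provides one: since \<open>\<psi> - a\<close> has no
  zeros, it has a square root \<open>s\<close>, and \<open>s\<close> never takes both a value and its negative. Hence \<open>s\<close>
  omits a disk around \<open>- s 0\<close>, and \<open>1 / (s + s 0)\<close> is bounded and small exactly where \<open>\<psi>\<close> is large.\<close>

lemma univalent_radial_limit_infinity:
  fixes \<psi> :: "complex \<Rightarrow> complex"
  assumes hol: "\<psi> holomorphic_on ball 0 1" and inj: "inj_on \<psi> (ball 0 1)"
    and omit: "\<And>z. norm z < 1 \<Longrightarrow> \<psi> z \<noteq> a"
    and J: "\<And>n::nat. open (J n)" "\<And>n. connected (J n)" "\<And>n. J n \<subseteq> ball 0 1" "\<And>n. \<zeta> \<in> closure (J n)"
    and big: "\<And>n z. z \<in> J n \<Longrightarrow> real n \<le> norm (\<psi> z)"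
    and \<zeta>: "norm \<zeta> = 1"
  shows "filterlim (\<lambda>r. \<psi> (of_real r * \<zeta>)) at_infinity (at_left (1::real))"
proof -
  obtain s where s: "s holomorphic_on ball 0 1" "\<And>z. z \<in> ball 0 1 \<Longrightarrow> \<psi> z - a = s z ^ 2"
  proof (rule contractible_imp_holomorphic_sqrt[of "\<lambda>z. \<psi> z - a" "ball 0 1"])
    show "(\<lambda>z. \<psi> z - a) holomorphic_on ball 0 1" using hol by (intro holomorphic_intros)
    show "contractible (ball (0::complex) 1)" by (simp add: convex_imp_contractible)
  qed (use omit in auto)
  have injs: "z = w" if "z \<in> ball 0 1" "w \<in> ball 0 1" "s z ^ 2 = s w ^ 2" for z w
    using that s(2) inj by (metis diff_add_cancel inj_onD)
  have s0: "s z \<noteq> 0" if "z \<in> ball 0 1" for z using s(2)[OF that] omit[of z] that by auto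
  have "inj_on s (ball 0 1)" by (rule inj_onI) (use injs in auto)
  then have "open (s ` ball 0 1)"
    using open_mapping_thm3[OF s(1)] by simp
  then obtain \<eta> where \<eta>: "\<eta> > 0" "ball (s 0) \<eta> \<subseteq> s ` ball 0 1"
    by (meson centre_in_ball image_eqI open_contains_ball zero_less_one)
  have away: "\<eta> \<le> norm (s z + s 0)" if z: "z \<in> ball 0 1" for z
  proof (rule ccontr)
    assume "\<not> ?thesis"
    then have "- s z \<in> ball (s 0) \<eta>" by (simp add: dist_norm add.commute)
    then obtain w where w: "w \<in> ball 0 1" "- s z = s w" using \<eta>(2) by blast
    then have "z = w" using injs[OF z w(1)] by (metis power2_minus)
    with w s0[OF z] show False by auto
  qed
  define g where "g = (\<lambda>z. of_real \<eta> / (s (z * \<zeta>) + s 0))"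
  have rot: "z * \<zeta> \<in> ball 0 1" if "z \<in> ball 0 1" for z using that \<zeta> by (simp add: norm_mult)
  have sum0: "s z + s 0 \<noteq> 0" if "z \<in> ball 0 1" for z using away[OF that] \<eta>(1) by auto
  have holg: "g holomorphic_on ball 0 1"
  proof -
    have "(s \<circ> (\<lambda>z. z * \<zeta>)) holomorphic_on ball 0 1"
      using rot by (intro holomorphic_on_compose_gen[OF _ s(1)] holomorphic_intros) auto
    then have "(\<lambda>z. s (z * \<zeta>)) holomorphic_on ball 0 1" by (simp add: o_def)
    then show ?thesis unfolding g_def using sum0 rot by (intro holomorphic_intros) auto
  qed
  have g1: "norm (g z) \<le> 1" if "norm z < 1" for z
    using away[of "z * \<zeta>"] rot[of z] that \<eta>(1) by (simp add: g_def norm_divide divide_simps)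
  have lim: "((\<lambda>r. g (of_real r)) \<longlongrightarrow> 0) (at_left (1::real))"
  proof (rule tendstoI)
    fix e0 :: real assume "0 < e0"
    define e where "e = min (e0/2) 1 ^ 4"
    have e: "0 < e" using \<open>0 < e0\<close> by (simp add: e_def)
    define B where "B = \<eta> / e + norm (s 0)"
    obtain n :: nat where n: "B^2 + norm a < n" using reals_Archimedean2 by blast
    define J' where "J' = {z. z * \<zeta> \<in> J n}"
    have \<zeta>0: "\<zeta> \<noteq> 0" using \<zeta> by auto
    have J'im: "J' = (\<lambda>z. z / \<zeta>) ` J n" unfolding J'_def using \<zeta>0 by (force simp: image_iff)
    have "\<forall>\<^sub>F r in at_left (1::real). norm (g (of_real r)) ^ 4 \<le> e"
    proof (rule bounded_holomorphic_small_on_radius[OF holg g1])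
      have "open ((\<lambda>z. z * \<zeta>) -` J n)" by (intro open_vimage J(1) continuous_intros)
      then show "open J'" by (simp add: J'_def vimage_def)
      show "connected J'" unfolding J'im using \<zeta>0
        by (intro connected_continuous_image J(2) continuous_intros) auto
      show "J' \<subseteq> ball 0 1" using J(3)[of n] \<zeta> by (auto simp: J'_def norm_mult)
      have "(\<lambda>z. z / \<zeta>) ` closure (J n) \<subseteq> closure J'" unfolding J'im
        using \<zeta>0 by (intro image_closure_subset closure_subset continuous_intros) auto
      moreover have "\<zeta> / \<zeta> = 1" using \<zeta>0 by simp
      ultimately show "1 \<in> closure J'" using J(4)[of n] by (metis image_eqI subsetD)
      show "norm (g z) \<le> e" if "z \<in> J'" for z
      proof -
        have z: "z * \<zeta> \<in> J n" "z * \<zeta> \<in> ball 0 1" using that J(3)[of n] by (auto simp: J'_def)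
        have "real n \<le> norm (\<psi> (z * \<zeta>))" using big[OF z(1)] .
        also have "\<dots> \<le> norm (s (z * \<zeta>))^2 + norm a"
          using norm_triangle_ineq[of "s (z * \<zeta>) ^ 2" a] s(2)[OF z(2)] by (metis diff_add_cancel norm_power)
        finally have "B^2 \<le> norm (s (z * \<zeta>))^2" using n by linarith
        then have "B \<le> norm (s (z * \<zeta>))" by (rule power2_le_imp_le) simp
        then have "\<eta> / e \<le> norm (s (z * \<zeta>)) - norm (s 0)" by (simp add: B_def)
        also have "\<dots> \<le> norm (s (z * \<zeta>) + s 0)" by (metis norm_diff_ineq)
        finally show ?thesis using e sum0[OF z(2)] by (simp add: g_def norm_divide field_simps \<eta>(1) less_imp_le)
      qed
    qed (use e in auto)
    then show "\<forall>\<^sub>F r in at_left (1::real). dist (g (of_real r)) 0 < e0"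
    proof eventually_elim
      case (elim r)
      then have "norm (g (of_real r)) \<le> min (e0/2) 1" unfolding e_def
        using \<open>0 < e0\<close> power_mono_iff[of "norm (g (of_real r))" "min (e0/2) 1" 4] by simp
      then show ?case using \<open>0 < e0\<close> by simp
    qed
  qed
  have ev: "\<forall>\<^sub>F r in at_left (1::real). r \<in> {0<..<1}"
    by (rule eventually_at_left_real) simp
  have gne: "\<forall>\<^sub>F r in at_left (1::real). g (of_real r) \<noteq> 0"
    using ev by eventually_elim (use sum0 rot \<eta>(1) in \<open>auto simp: g_def\<close>)
  have "filterlim (\<lambda>r. inverse (g (of_real r))) at_infinity (at_left (1::real))"
    using lim gne by (intro filterlim_compose[OF filterlim_inverse_at_infinity])
      (auto simp: filterlim_at)
  then have "filterlim (\<lambda>r. (of_real \<eta> * inverse (g (of_real r)) + (- s 0))) at_infinity (at_left (1::real))"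
    using \<eta>(1) by (intro tendsto_add_filterlim_at_infinity' tendsto_mult_filterlim_at_infinity) auto
  from Limits.filterlim_power_at_infinity[OF this, of 2]
  have "filterlim (\<lambda>r. ((of_real \<eta> * inverse (g (of_real r)) + (- s 0)) ^ 2) + a) at_infinity (at_left (1::real))"
    by (intro tendsto_add_filterlim_at_infinity') auto
  then show ?thesis
  proof (rule filterlim_cong[THEN iffD1, rotated -1])
    show "\<forall>\<^sub>F r in at_left (1::real). (of_real \<eta> * inverse (g (of_real r)) + (- s 0)) ^ 2 + a = \<psi> (of_real r * \<zeta>)"
      using ev
    proof eventually_elim
      case (elim r)
      have "of_real r * \<zeta> \<in> ball 0 1" using elim \<zeta> by (simp add: norm_mult)
      then show ?case using s(2)[of "of_real r * \<zeta>"] \<eta>(1) by (simp add: g_def flip: s(2))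
    qed
  qed auto
qed

text \<open>The closures of the preimages of the escaping domains are nested compact sets, so they have a
  common point. It lies on the unit circle, because near a point of the open disk \<open>\<psi>\<close> is bounded.\<close>

lemma univalent_radial_limit_infinity_exists:
  assumes hol: "\<psi> holomorphic_on ball 0 1" and cont: "continuous_on V f"
    and \<psi>: "\<And>z. z \<in> ball 0 1 \<Longrightarrow> \<psi> z \<in> V \<and> f (\<psi> z) = z"
    and f: "\<And>w. w \<in> V \<Longrightarrow> f w \<in> ball 0 1 \<and> \<psi> (f w) = w"
    and V: "open V" "a \<notin> V" "E \<subseteq> V" and E: "closed E" "connected E" "\<not> bounded E"
  obtains \<zeta> :: complex where "norm \<zeta> = 1" "filterlim (\<lambda>r. \<psi> (of_real r * \<zeta>)) at_infinity (at_left (1::real))"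
proof -
  obtain N :: "nat \<Rightarrow> complex set" where N: "\<And>n. open (N n)" "\<And>n. connected (N n)" "\<And>n. N n \<noteq> {}"
    "\<And>n. N n \<subseteq> V" "decseq N" "\<And>n w. w \<in> N n \<Longrightarrow> real n \<le> norm w"
    using unbounded_connected_imp_escaping_domains[OF V(1,3) E] by metis
  define J where "J = (\<lambda>n. f ` N n)"
  have Jeq: "J n = ball 0 1 \<inter> \<psi> -` N n" for n
    unfolding J_def using \<psi> f N(4)[of n] by (force simp: image_iff)
  have c\<psi>: "continuous_on (ball 0 1) \<psi>" using hol by (rule holomorphic_on_imp_continuous_on)
  have oJ: "open (J n)" for n
    unfolding Jeq by (intro continuous_open_preimage c\<psi> N(1)) auto
  have cJ: "connected (J n)" for n
    unfolding J_def by (intro connected_continuous_image N(2) continuous_on_subset[OF cont N(4)])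
  have Jb: "J n \<subseteq> ball 0 1" for n unfolding Jeq by auto
  have "(\<Inter>n. closure (J n)) \<noteq> {}"
  proof (rule compact_nest)
    show "compact (closure (J n))" for n
      using Jb[of n] by (simp add: bounded_subset[OF bounded_ball])
    show "closure (J n) \<noteq> {}" for n using N(3)[of n] by (simp add: J_def)
    show "closure (J n) \<subseteq> closure (J m)" if "m \<le> n" for m n
      using decseqD[OF N(5) that] by (intro closure_mono) (auto simp: J_def)
  qed
  then obtain \<zeta> where \<zeta>: "\<And>n. \<zeta> \<in> closure (J n)" by blast
  have "norm \<zeta> \<le> 1"
    using \<zeta>[of 0] Jb[of 0] closure_minimal[of "J 0" "cball 0 1"] by force
  moreover have "\<not> norm \<zeta> < 1"
  proof
    assume "norm \<zeta> < 1"
    obtain n where n: "norm (\<psi> \<zeta>) + 1 < real n" using reals_Archimedean2 by blast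
    have "isCont \<psi> \<zeta>" using c\<psi> \<open>norm \<zeta> < 1\<close> by (simp add: continuous_on_eq_continuous_at)
    then obtain d where d: "d > 0" "\<And>z. dist z \<zeta> < d \<Longrightarrow> dist (\<psi> z) (\<psi> \<zeta>) < 1"
      unfolding continuous_at_eps_delta by (metis zero_less_one)
    obtain z where z: "z \<in> J n" "dist z \<zeta> < d" using \<zeta>[of n] d(1) closure_approachable by blast
    have "real n \<le> norm (\<psi> z)" using z(1) N(6) by (simp add: Jeq)
    moreover have "norm (\<psi> z) \<le> norm (\<psi> \<zeta>) + 1" using d(2)[OF z(2)] by norm
    ultimately show False using n by simp
  qed
  ultimately have n1: "norm \<zeta> = 1" by simp
  have "filterlim (\<lambda>r. \<psi> (of_real r * \<zeta>)) at_infinity (at_left (1::real))"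
  proof (rule univalent_radial_limit_infinity[where J = J and a = a])
    show "inj_on \<psi> (ball 0 1)" using \<psi> by (metis inj_onI)
    show "\<psi> z \<noteq> a" if "norm z < 1" for z using \<psi>[of z] that V(2) by auto
    show "real n \<le> norm (\<psi> z)" if "z \<in> J n" for n z using that N(6) by (simp add: Jeq)
  qed (use hol oJ cJ Jb \<zeta> n1 in auto)
  with n1 that show ?thesis by blast
qed

section \<open>Inversion at a boundary point\<close>

definition inversion_at :: "complex \<Rightarrow> complex \<Rightarrow> complex" where
  "inversion_at p z = inverse (z - p)"

text \<open>The inverse of \<open>inversion_at p\<close>, with values in the sphere: the origin corresponds to infinity.\<close>

definition outward_chart :: "complex \<Rightarrow> complex \<Rightarrow> complex option" where
  "outward_chart p w = (if w = 0 then None else Some (p + inverse w))"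

text \<open>The image of \<open>U \<union> {\<infinity>}\<close> under \<open>1 / (z - p)\<close>, as a plane domain.\<close>

definition inverted_domain :: "complex \<Rightarrow> complex set \<Rightarrow> complex set" where
  "inverted_domain p U = insert 0 (inversion_at p ` U)"

lemma mem_inversion_at_image:
  assumes "p \<notin> A"
  shows "w \<in> inversion_at p ` A \<longleftrightarrow> w \<noteq> 0 \<and> p + inverse w \<in> A"
proof
  assume "w \<in> inversion_at p ` A"
  then show "w \<noteq> 0 \<and> p + inverse w \<in> A" using assms by (auto simp: inversion_at_def)
next
  assume "w \<noteq> 0 \<and> p + inverse w \<in> A"
  then show "w \<in> inversion_at p ` A" by (auto simp: inversion_at_def image_iff intro!: bexI[of _ "p + inverse w"])
qed

lemma closed_inversion_at_image:
  assumes "compact K"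
  shows "closed (inversion_at p ` (K - {p}))"
proof -
  obtain B where B: "B > 0" "\<And>z. z \<in> K \<Longrightarrow> norm (z - p) \<le> B"
  proof -
    have "bounded ((\<lambda>z. z - p) ` K)" using assms
      by (intro compact_imp_bounded compact_continuous_image continuous_intros)
    then show ?thesis using that unfolding bounded_pos by auto
  qed
  have far: "inverse B \<le> norm w" if "w \<in> inversion_at p ` (K - {p})" for w
    using that B by (auto simp: inversion_at_def norm_inverse intro!: le_imp_inverse_le)
  have "closedin (top_of_set (- {0})) ((- {0}) \<inter> (\<lambda>w. p + inverse w) -` K)"
    using assms by (intro continuous_closedin_preimage continuous_intros compact_imp_closed) auto
  also have "(- {0}) \<inter> (\<lambda>w. p + inverse w) -` K = inversion_at p ` (K - {p})"
    unfolding set_eq_iff by (simp add: mem_inversion_at_image) blast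
  finally obtain C where C: "closed C" "inversion_at p ` (K - {p}) = (- {0}) \<inter> C"
    by (metis closedin_closed)
  have "inversion_at p ` (K - {p}) = C \<inter> {w. inverse B \<le> norm w}"
    using C(2) far B(1) by (auto simp: set_eq_iff)
  moreover have "closed {w::complex. inverse B \<le> norm w}"
    by (intro closed_Collect_le continuous_intros)
  ultimately show ?thesis using C(1) by (metis closed_Int)
qed

text \<open>Simple connectivity says that no component of the complement is bounded. A bounded one would lie in
  a compact relatively open piece of the complement, and undoing the inversion would turn that piece
  into an open and closed subset of \<open>- U\<close> without \<open>p\<close>, although \<open>- U\<close> is connected. The last claim
  holds because the frontier of \<open>U\<close> lies in \<open>K\<close>.\<close>

lemma inverted_domain_properties:
  assumes K: "compact K" "connected K" "p \<in> K" and U: "U \<in> components (- K)" "\<not> bounded U"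
  shows "open (inverted_domain p U)" "simply_connected (inverted_domain p U)"
    and "\<And>E. \<lbrakk>connected E; 0 \<in> E; E \<inter> inversion_at p ` (K - {p}) = {}\<rbrakk> \<Longrightarrow> E \<subseteq> inverted_domain p U"
proof -
  define V where "V = inverted_domain p U"
  have oU: "open U" using U(1) K(1) by (meson open_components open_Compl compact_imp_closed)
  have UK: "U \<subseteq> - K" using U(1) in_components_subset by blast
  have cU: "connected U" using U(1) in_components_connected by blast
  have pU: "p \<notin> U" using UK K(3) by auto
  have memV: "w \<in> V \<longleftrightarrow> w = 0 \<or> p + inverse w \<in> U" for w
    using mem_inversion_at_image[OF pU] by (auto simp: V_def inverted_domain_def)
  obtain d where d: "d > 0" "ball 0 d \<subseteq> V"
  proof -
    obtain B where B: "B > 0" "K \<subseteq> ball p B"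
      using bounded_subset_ballD[OF compact_imp_bounded[OF K(1)], of p] by blast
    have "connected (- ball p B)"
      by (rule connected_complement_bounded_convex) auto
    moreover have "\<not> U \<subseteq> ball p B" using U(2) bounded_subset bounded_ball by blast
    ultimately have sub: "- ball p B \<subseteq> U"
      using components_maximal[OF U(1), of "- ball p B"] B(2) by blast
    show ?thesis
    proof
      show "ball 0 (inverse B) \<subseteq> V"
      proof
        fix w :: complex assume w: "w \<in> ball 0 (inverse B)"
        have "p + inverse w \<notin> ball p B" if "w \<noteq> 0"
          using w that B(1) by (simp add: dist_norm norm_divide norm_minus_commute field_simps)
        then show "w \<in> V" using sub by (auto simp: memV)
      qed
    qed (use B in auto)
  qed
  have Veq: "V = ((- {0}) \<inter> (\<lambda>w. p + inverse w) -` U) \<union> ball 0 d"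
    using d by (auto simp: memV)
  have "open ((- {0}) \<inter> (\<lambda>w. p + inverse w) -` U)"
    using oU by (intro continuous_open_preimage continuous_intros) auto
  then have oV: "open V" unfolding Veq by (intro open_Un) auto
  then show "open (inverted_domain p U)" by (simp add: V_def)
  have cV: "connected V"
  proof -
    have "V = inversion_at p ` U \<union> ball 0 d" using d by (auto simp: V_def inverted_domain_def)
    moreover have "connected (inversion_at p ` U)"
      unfolding inversion_at_def using pU
      by (intro connected_continuous_image continuous_intros cU) auto
    moreover have "inversion_at p ` U \<inter> ball 0 d \<noteq> {}"
    proof -
      have "of_real (d/2) \<in> V" using d by (intro subsetD[OF d(2)]) auto
      then have "of_real (d/2) \<in> inversion_at p ` U" using d(1) by (auto simp: V_def inverted_domain_def)
      moreover have "complex_of_real (d/2) \<in> ball 0 d" using d(1) by simp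
      ultimately show ?thesis by blast
    qed
    ultimately show ?thesis by (metis connected_Un connected_ball)
  qed
  have Y: "connected (- U)" using component_complement_connected[OF K(2) U(1)] .
  have "\<not> bounded C" if C: "C \<in> components (- V)" for C
  proof
    assume "bounded C"
    obtain a where a: "a \<notin> V" "C = connected_component_set (- V) a" using C by (auto simp: components_def)
    obtain A where A: "compact A" "a \<in> A" "openin (top_of_set (- V)) A"
      using bounded_component_imp_compact_clopen[of "- V" a] a \<open>bounded C\<close> oV
      by (metis Compl_iff closed_Compl)
    obtain G where G: "open G" "A = - V \<inter> G" using A(3) openin_open by blast
    define A' where "A' = (\<lambda>w. p + inverse w) ` A"
    have A0: "0 \<notin> A" using G(2) memV by auto
    \<comment> \<open>Openness of the piece carries over in this form, because inversion is continuous off \<open>p\<close>.\<close>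
    have A'eq: "A' = - U \<inter> (- {p} \<inter> inversion_at p -` G)"
    proof (intro equalityI subsetI)
      fix z assume "z \<in> A'"
      then obtain w where w: "w \<in> A" "z = p + inverse w" by (auto simp: A'_def)
      then have "w \<noteq> 0" using A0 by auto
      then show "z \<in> - U \<inter> (- {p} \<inter> inversion_at p -` G)"
        using w G(2) memV[of w] by (auto simp: inversion_at_def)
    next
      fix z assume z: "z \<in> - U \<inter> (- {p} \<inter> inversion_at p -` G)"
      then have "z = p + inverse (inversion_at p z)" "inversion_at p z \<noteq> 0" by (auto simp: inversion_at_def)
      moreover from this have "inversion_at p z \<in> A" using z G(2) memV[of "inversion_at p z"] by auto
      ultimately show "z \<in> A'" unfolding A'_def by blast
    qed
    have "open (- {p} \<inter> inversion_at p -` G)"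
      unfolding inversion_at_def using G(1)
      by (intro continuous_open_preimage continuous_intros) auto
    then have "openin (top_of_set (- U)) A'" unfolding A'eq by (simp add: openin_open_Int)
    moreover have "compact A'" unfolding A'_def using A(1) A0
      by (intro compact_continuous_image continuous_intros) auto
    then have "closedin (top_of_set (- U)) A'"
      using A'eq by (intro closed_subset compact_imp_closed) auto
    moreover have "A' \<noteq> {}" using A(2) by (auto simp: A'_def)
    moreover have "A' \<noteq> - U" using A'eq pU by auto
    ultimately show False using Y unfolding connected_clopen by blast
  qed
  then show "simply_connected (inverted_domain p U)"
    using cV oV simply_connected_eq_unbounded_complement_components V_def by metis
  fix E assume E: "connected E" "0 \<in> E" "E \<inter> inversion_at p ` (K - {p}) = {}"
  show "E \<subseteq> inverted_domain p U"
  proof (rule ccontr)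
    assume "\<not> ?thesis"
    then have "E \<inter> frontier V \<noteq> {}"
      using E(1,2) memV[of 0] by (intro connected_Int_frontier) (auto simp: V_def)
    then obtain w where w: "w \<in> E" "w \<in> closure V" "w \<notin> V"
      using oV by (auto simp: frontier_def interior_open)
    then have w0: "w \<noteq> 0" and wU: "p + inverse w \<notin> U" using memV by auto
    have "p + inverse w \<in> closure U"
    proof (rule ccontr)
      assume "p + inverse w \<notin> closure U"
      moreover have "open (- {0} \<inter> (\<lambda>w. p + inverse w) -` (- closure U))"
        by (intro continuous_open_preimage continuous_intros) auto
      ultimately obtain v where "v \<in> V" "v \<noteq> 0" "p + inverse v \<notin> closure U"
        using w(2) w0 open_Int_closure_eq_empty[of "- {0} \<inter> (\<lambda>w. p + inverse w) -` (- closure U)" V]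
        by auto
      then show False using memV closure_subset by blast
    qed
    moreover have "closure U \<subseteq> U \<union> K"
      using frontier_of_components_closed_complement[OF compact_imp_closed[OF K(1)] U(1)]
        oU by (auto simp: frontier_def interior_open)
    ultimately have "p + inverse w \<in> K" using wU by blast
    then have "w \<in> inversion_at p ` (K - {p})" using w0 mem_inversion_at_image[of p "K - {p}" w] by simp
    then show False using E(3) w(1) by blast
  qed
qed

lemma normalized_riemann_map_exists:
  assumes "open V" "simply_connected V" "0 \<in> V" "V \<noteq> UNIV"
  obtains \<psi> f and c :: real where "\<psi> holomorphic_on ball 0 1" "continuous_on V f"
    "\<And>z. z \<in> ball 0 1 \<Longrightarrow> \<psi> z \<in> V \<and> f (\<psi> z) = z"
    "\<And>w. w \<in> V \<Longrightarrow> f w \<in> ball 0 1 \<and> \<psi> (f w) = w"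
    "\<psi> 0 = 0" "c > 0" "(\<psi> has_field_derivative of_real c) (at 0)"
proof -
  obtain f0 g0 where fg: "f0 holomorphic_on V" "g0 holomorphic_on ball 0 1"
    "\<And>z. z \<in> V \<Longrightarrow> f0 z \<in> ball 0 1 \<and> g0 (f0 z) = z"
    "\<And>z. z \<in> ball 0 1 \<Longrightarrow> g0 z \<in> V \<and> f0 (g0 z) = z"
    using Riemann_mapping_theorem[of V] assms by blast
  obtain m n where mn0: "m (f0 0) = 0" "m holomorphic_on ball 0 1" "m ` ball 0 1 \<subseteq> ball 0 1"
     "n holomorphic_on ball 0 1" "n ` ball 0 1 \<subseteq> ball 0 1"
     "\<And>z. z \<in> ball 0 1 \<Longrightarrow> m (n z) = z" "\<And>z. z \<in> ball 0 1 \<Longrightarrow> n (m z) = z"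
    by (rule ball_biholomorphism_exists[of "f0 0"]) (use fg(3)[OF assms(3)] in blast)+
  have mn: "m (f0 0) = 0" "m holomorphic_on ball 0 1" "n holomorphic_on ball 0 1"
     "\<And>z. z \<in> ball 0 1 \<Longrightarrow> m z \<in> ball 0 1 \<and> n (m z) = z"
     "\<And>z. z \<in> ball 0 1 \<Longrightarrow> n z \<in> ball 0 1 \<and> m (n z) = z"
    using mn0(3,5) by (simp_all only: mn0(1,2,4,6,7) image_subset_iff) 
  define h where "h = g0 \<circ> n"
  have holh: "h holomorphic_on ball 0 1" unfolding h_def
    using mn(5) by (intro holomorphic_on_compose_gen[OF mn(3) fg(2)]) auto
  have n0: "n 0 = f0 0" using mn(4)[of "f0 0"] fg(3)[OF assms(3)] mn(1) by simp
  then have h0: "h 0 = 0" using fg(3)[OF assms(3)] by (simp add: h_def)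
  have injh: "inj_on h (ball 0 1)"
    by (rule inj_onI) (metis comp_apply h_def fg(4) mn(5))
  define D where "D = deriv h 0"
  have D0: "D \<noteq> 0" unfolding D_def
    by (rule holomorphic_injective_imp_regular[OF holh _ injh]) auto
  have derh: "(h has_field_derivative D) (at 0)" unfolding D_def
    by (rule holomorphic_derivI[OF holh]) auto
  \<comment> \<open>Rotating the disk by \<open>u\<close> makes the derivative at the centre positive.\<close>
  define u where "u = of_real (norm D) / D"
  have nu: "norm u = 1" using D0 by (simp add: u_def norm_divide)
  then have u0: "u \<noteq> 0" by auto
  define \<psi> where "\<psi> = (\<lambda>z. h (u * z))"
  define f where "f = (\<lambda>w. m (f0 w) / u)"
  have rot: "u * z \<in> ball 0 1" if "z \<in> ball 0 1" for z using that nu by (simp add: norm_mult)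
  show ?thesis
  proof
    have "(h \<circ> (\<lambda>z. u * z)) holomorphic_on ball 0 1"
      using rot by (intro holomorphic_on_compose_gen[OF _ holh] holomorphic_intros) auto
    then show "\<psi> holomorphic_on ball 0 1" by (simp add: \<psi>_def o_def)
    have "(m \<circ> f0) holomorphic_on V"
      using fg(3) by (intro holomorphic_on_compose_gen[OF fg(1) mn(2)]) auto
    then have "continuous_on V (m \<circ> f0)" by (rule holomorphic_on_imp_continuous_on)
    then show "continuous_on V f" unfolding f_def o_def using u0 by (intro continuous_intros) auto
    show "\<psi> z \<in> V \<and> f (\<psi> z) = z" if "z \<in> ball 0 1" for z
    proof -
      have "n (u * z) \<in> ball 0 1" "m (n (u * z)) = u * z" using mn(5)[OF rot[OF that]] by auto
      then show ?thesis using fg(4)[of "n (u * z)"] u0 by (simp add: \<psi>_def f_def h_def)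
    qed
    show "f w \<in> ball 0 1 \<and> \<psi> (f w) = w" if "w \<in> V" for w
    proof -
      have "m (f0 w) \<in> ball 0 1" "n (m (f0 w)) = f0 w" "g0 (f0 w) = w"
        using fg(3)[OF that] mn(4)[of "f0 w"] by auto
      then show ?thesis using u0 nu by (simp add: \<psi>_def f_def h_def norm_divide)
    qed
    show "\<psi> 0 = 0" by (simp add: \<psi>_def h0)
    show "norm D > 0" using D0 by simp
    have "(\<psi> has_field_derivative (D * u)) (at 0)"
      unfolding \<psi>_def
      by (rule DERIV_chain2[of h D]) (use derh in \<open>auto intro!: derivative_eq_intros\<close>)
    then show "(\<psi> has_field_derivative of_real (norm D)) (at 0)" using D0 by (simp add: u_def)
  qed
qed


section \<open>The exterior Riemann map and its rays\<close>

lemma continuous_map_outward_chart: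
  "continuous_map euclidean riemann_sphere (outward_chart p)"
  unfolding continuous_map_def
proof (intro conjI allI impI)
  show "outward_chart p \<in> topspace euclidean \<rightarrow> topspace riemann_sphere"
    by (auto simp: riemann_sphere_def outward_chart_def)
  fix S assume "openin riemann_sphere S"
  then consider G where "open G" "S = Some ` G" | C where "compact C" "S = insert None (Some ` (- C))"
    by (auto simp: riemann_sphere_def openin_Alexandroff_compactification Compl_eq_Diff_UNIV)
  then show "openin euclidean {x \<in> topspace euclidean. outward_chart p x \<in> S}"
  proof cases
    case 1
    have "{x \<in> topspace euclidean. outward_chart p x \<in> S} = - {0} \<inter> (\<lambda>w. p + inverse w) -` G"
      unfolding 1 by (auto simp: outward_chart_def)
    moreover have "open \<dots>" using 1 by (intro continuous_open_preimage continuous_intros) auto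
    ultimately show ?thesis by simp
  next
    case 2
    have "{x \<in> topspace euclidean. outward_chart p x \<in> S} = - (inversion_at p ` (C - {p}))"
      unfolding 2 set_eq_iff by (auto simp: outward_chart_def mem_inversion_at_image)
    moreover have "open \<dots>" using closed_inversion_at_image[OF 2(1)] by (rule open_Compl)
    ultimately show ?thesis by simp
  qed
qed

lemma exterior_riemann_map_from_inverted_domain:
  assumes pU: "p \<notin> U" and hol: "\<psi> holomorphic_on ball 0 1" and V: "V = inverted_domain p U"
    and \<psi>: "\<And>z. z \<in> ball 0 1 \<Longrightarrow> \<psi> z \<in> V \<and> f (\<psi> z) = z"
    and f: "\<And>w. w \<in> V \<Longrightarrow> f w \<in> ball 0 1 \<and> \<psi> (f w) = w"
    and \<psi>0: "\<psi> 0 = 0" and c: "c > 0" "(\<psi> has_field_derivative of_real c) (at 0)"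
  shows "exterior_riemann_map U (outward_chart p \<circ> \<psi>)"
proof -
  define \<phi> where "\<phi> = outward_chart p \<circ> \<psi>"
  have \<psi>z: "\<psi> z = 0 \<longleftrightarrow> z = 0" if "z \<in> ball 0 1" for z
    using \<psi>[OF that] \<psi>[of 0] \<psi>0 by auto
  have cont\<psi>: "continuous_on (ball 0 1) \<psi>" using hol by (rule holomorphic_on_imp_continuous_on)
  have fin: "finite_chart (\<phi> z) = p + inverse (\<psi> z)" if "z \<in> ball 0 1" "z \<noteq> 0" for z
    using that \<psi>z by (simp add: \<phi>_def outward_chart_def finite_chart_def)
  \<comment> \<open>Written this way, the chart at infinity is visibly holomorphic at the zero of \<open>\<psi>\<close>.\<close>
  have inf: "infinity_chart (\<phi> z) = \<psi> z / (1 + p * \<psi> z)" if "z \<in> ball 0 1" for z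
  proof (cases "\<psi> z = 0")
    case False
    then have "p + inverse (\<psi> z) = (1 + p * \<psi> z) / \<psi> z" by (simp add: field_simps)
    then show ?thesis using False by (simp add: \<phi>_def outward_chart_def infinity_chart_def)
  qed (simp add: \<phi>_def outward_chart_def infinity_chart_def)
  have "continuous_map (top_of_set (ball 0 1)) riemann_sphere \<phi>"
    unfolding \<phi>_def using cont\<psi> continuous_map_outward_chart
    by (intro continuous_map_compose[of _ euclidean]) auto
  moreover have "(infinity_chart \<circ> \<phi>) analytic_on {0}"
  proof -
    define S where "S = ball 0 1 \<inter> \<psi> -` {w. 1 + p * w \<noteq> 0}"
    have "open S" unfolding S_def
      using cont\<psi> by (intro continuous_open_preimage open_Collect_neq continuous_intros) auto
    moreover have "0 \<in> S" by (simp add: S_def \<psi>0)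
    moreover have "(\<lambda>z. \<psi> z / (1 + p * \<psi> z)) holomorphic_on S"
      by (intro holomorphic_intros holomorphic_on_subset[OF hol]) (auto simp: S_def)
    then have "(infinity_chart \<circ> \<phi>) holomorphic_on S"
      by (rule holomorphic_transform) (auto simp: S_def inf)
    ultimately show ?thesis by (auto simp: analytic_at)
  qed
  moreover have "(finite_chart \<circ> \<phi>) analytic_on {z}" if "z \<in> ball 0 1" "z \<noteq> 0" for z
  proof -
    have "(\<lambda>z. p + inverse (\<psi> z)) holomorphic_on (ball 0 1 - {0})"
      using \<psi>z by (intro holomorphic_intros holomorphic_on_subset[OF hol]) auto
    then have "(finite_chart \<circ> \<phi>) holomorphic_on (ball 0 1 - {0})"
      by (rule holomorphic_transform) (auto simp: fin)
    moreover have "open (ball 0 1 - {0::complex})" by auto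
    ultimately show ?thesis using that unfolding analytic_at by blast
  qed
  moreover have \<phi>N: "\<phi> z = None \<longleftrightarrow> z = 0" if "z \<in> ball 0 1" for z
    using \<psi>z[OF that] by (simp add: \<phi>_def outward_chart_def)
  ultimately have "sphere_holomorphic_on \<phi> (ball 0 1)"
    unfolding sphere_holomorphic_on_def by auto
  moreover have "bij_betw \<phi> (ball 0 1) (insert None (Some ` U))"
    unfolding \<phi>_def
  proof (rule bij_betw_trans[of _ _ V])
    show "bij_betw \<psi> (ball 0 1) V"
      by (rule bij_betw_byWitness[of _ f]) (use \<psi> f in auto)
    have inj: "inj_on (outward_chart p) V" by (auto simp: inj_on_def outward_chart_def split: if_splits)
    moreover have "outward_chart p ` V = insert None (Some ` U)"
    proof (intro equalityI subsetI)
      fix y assume "y \<in> outward_chart p ` V"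
      then show "y \<in> insert None (Some ` U)"
        using pU mem_inversion_at_image[OF pU] by (auto simp: V inverted_domain_def outward_chart_def split: if_splits)
    next
      fix y assume "y \<in> insert None (Some ` U)"
      then show "y \<in> outward_chart p ` V"
      proof
        assume "y = None" then show ?thesis by (auto simp: V inverted_domain_def outward_chart_def)
      next
        assume "y \<in> Some ` U"
        then obtain z where z: "z \<in> U" "y = Some z" by auto
        then have "outward_chart p (inversion_at p z) = y" using pU by (auto simp: outward_chart_def inversion_at_def)
        then show ?thesis using z(1) by (auto simp: V inverted_domain_def)
      qed
    qed
    ultimately show "bij_betw (outward_chart p) V (insert None (Some ` U))" by (simp add: bij_betw_def)
  qed
  moreover have "\<phi> 0 = None" by (simp add: \<phi>N)
  moreover have "((\<lambda>z. z * finite_chart (\<phi> z)) \<longlongrightarrow> complex_of_real (inverse c)) (at 0)"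
  proof -
    have "((\<lambda>z. \<psi> z / z) \<longlongrightarrow> of_real c) (at 0)"
      using c(2) \<psi>0 by (simp add: has_field_derivative_iff)
    then have "((\<lambda>z. z * p + inverse (\<psi> z / z)) \<longlongrightarrow> 0 * p + inverse (of_real c)) (at 0)"
      using c(1) by (intro tendsto_intros) auto
    then have "((\<lambda>z. z * p + inverse (\<psi> z / z)) \<longlongrightarrow> of_real (inverse c)) (at 0)" by simp
    then show ?thesis
    proof (rule Lim_transform_within_open[of _ _ _ _ "ball 0 1"])
      show "z * p + inverse (\<psi> z / z) = z * finite_chart (\<phi> z)" if "z \<in> ball 0 1" "z \<noteq> 0" for z
        using fin[OF that] by (simp add: algebra_simps divide_inverse)
    qed auto
  qed
  moreover have "inverse c > 0" using c(1) by simp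
  ultimately show ?thesis unfolding exterior_riemann_map_def conformal_iso_def \<phi>_def[symmetric] by blast
qed

text \<open>Up to a given radius the ray is the image of a compact segment, hence closed in the sphere, and
  beyond a suitable radius it stays in any prescribed closed disk around \<open>p\<close>. So the closure can
  only add \<open>p\<close>.\<close>

lemma external_ray_lands:
  assumes \<phi>: "exterior_riemann_map U \<phi>" and pU: "p \<notin> U"
    and lim: "((\<lambda>r. finite_chart (\<phi> (of_real r * cis \<theta>))) \<longlongrightarrow> p) (at_left (1::real))"
  shows "lands_on (external_ray \<phi> \<theta>) p"
proof -
  define R where "R = external_ray \<phi> \<theta>"
  have contphi: "continuous_map (top_of_set (ball 0 1)) riemann_sphere \<phi>"
    and bij: "bij_betw \<phi> (ball 0 1) (insert None (Some ` U))" and \<phi>0: "\<phi> 0 = None"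
    using \<phi> by (auto simp: exterior_riemann_map_def conformal_iso_def sphere_holomorphic_on_def)
  have haus: "Hausdorff_space riemann_sphere"
    by (simp add: riemann_sphere_def Hausdorff_space_Alexandroff_compactification locally_compact_space_euclidean)
  have inball: "of_real r * cis \<theta> \<in> ball 0 1" if "0 \<le> r" "r < 1" for r
    using that by (simp add: norm_mult)
  have nonzero: "\<exists>y\<in>U. \<phi> (of_real r * cis \<theta>) = Some y" if "0 < r" "r < 1" for r
  proof -
    have z: "of_real r * cis \<theta> \<in> ball 0 1" "of_real r * cis \<theta> \<noteq> 0" using inball that by auto
    have "\<phi> (of_real r * cis \<theta>) \<noteq> None"
      using z \<phi>0 bij by (metis bij_betw_inv_into_left centre_in_ball zero_less_one)
    then show ?thesis using bij_betwE[OF bij, rule_format, OF z(1)] by auto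
  qed
  have near: "\<forall>\<^sub>F r in at_left 1. 0 < r \<and> r < 1 \<and> (\<exists>y\<in>U. dist y p < e \<and> \<phi> (of_real r * cis \<theta>) = Some y)"
    if "e > 0" for e
  proof -
    have ev: "\<forall>\<^sub>F r in at_left (1::real). r \<in> {0<..<1}"
      by (rule eventually_at_left_real) simp
    from tendstoD[OF lim that] ev show ?thesis
    proof eventually_elim
      case (elim r)
      then obtain y where "y \<in> U" "\<phi> (of_real r * cis \<theta>) = Some y" using nonzero[of r] by auto
      with elim show ?case by (auto simp: finite_chart_def)
    qed
  qed
  have "Some p \<notin> R"
  proof
    assume "Some p \<in> R"
    then obtain r where "0 \<le> r" "r < 1" "Some p = \<phi> (of_real r * cis \<theta>)"
      by (auto simp: R_def external_ray_def)
    then have "Some p \<in> insert None (Some ` U)" using bij_betwE[OF bij] inball by metis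
    then show False using pU by auto
  qed
  moreover have "Some p \<in> riemann_sphere closure_of R"
    unfolding in_closure_of
  proof (intro conjI allI impI)
    show "Some p \<in> topspace riemann_sphere" by (simp add: riemann_sphere_def)
    fix T assume T: "Some p \<in> T \<and> openin riemann_sphere T"
    have "openin euclidean {y \<in> topspace euclidean. Some y \<in> T}"
      using T continuous_map_Some[of euclidean] unfolding continuous_map_def riemann_sphere_def by blast
    then have "open {y. Some y \<in> T}" by simp
    then obtain e where e: "e > 0" "ball p e \<subseteq> {y. Some y \<in> T}" using T by (auto simp: open_contains_ball)
    have "\<exists>r. 0 < r \<and> r < 1 \<and> (\<exists>y\<in>U. dist y p < e \<and> \<phi> (of_real r * cis \<theta>) = Some y)"
      using near[OF e(1)] eventually_happens'[of "at_left (1::real)"] trivial_limit_at_left_real[of 1] by blast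
    then obtain r y where "0 < r" "r < 1" "dist y p < e" "\<phi> (of_real r * cis \<theta>) = Some y" by blast
    then have "Some y \<in> R" "Some y \<in> T" using e(2)
      by (auto simp: R_def external_ray_def dist_commute image_iff subset_iff intro!: exI[of _ r])
    then show "\<exists>y. y \<in> R \<and> y \<in> T" by blast
  qed
  moreover have "y \<in> R \<or> y = Some p" if y: "y \<in> riemann_sphere closure_of R" for y
  proof (rule ccontr)
    assume ny: "\<not> ?thesis"
    obtain e where e: "e > 0" "y \<notin> Some ` cball p e"
    proof (cases y)
      case (Some y')
      then have "dist y' p > 0" using ny by auto
      moreover from this have "y \<notin> Some ` cball p (dist y' p / 2)"
        unfolding Some by (auto simp: dist_commute)
      ultimately show ?thesis using that[of "dist y' p / 2"] by simp
    qed (use that[of 1] in auto)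
    obtain b where b: "b < 1" "\<And>r. b < r \<Longrightarrow> r < 1 \<Longrightarrow> 
        (\<exists>y\<in>U. dist y p < e \<and> \<phi> (of_real r * cis \<theta>) = Some y)"
      using near[OF e(1)] unfolding eventually_at_left_field by blast
    define I where "I = (\<lambda>r. of_real r * cis \<theta>) ` {0..max b 0}"
    have "compact I" unfolding I_def by (intro compact_continuous_image continuous_intros) auto
    moreover have "I \<subseteq> ball 0 1" using inball b(1) by (auto simp: I_def)
    ultimately have "compactin riemann_sphere (\<phi> ` I)"
      by (intro image_compactin[OF _ contphi]) (simp add: compactin_subtopology)
    then have "closedin riemann_sphere (\<phi> ` I)" by (rule compactin_imp_closedin[OF haus])
    moreover have "closedin riemann_sphere (Some ` cball p e)" by (simp add: riemann_sphere_def)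
    ultimately have "closedin riemann_sphere (\<phi> ` I \<union> Some ` cball p e)" by (rule closedin_Un)
    moreover have "R \<subseteq> \<phi> ` I \<union> Some ` cball p e"
    proof
      fix x assume "x \<in> R"
      then obtain r where r: "0 \<le> r" "r < 1" "x = \<phi> (of_real r * cis \<theta>)" by (auto simp: R_def external_ray_def)
      show "x \<in> \<phi> ` I \<union> Some ` cball p e"
      proof (cases "r \<le> max b 0")
        case False
        then have "b < r" by linarith
        then obtain y' where "dist y' p < e" "x = Some y'" using b(2)[of r] r by auto
        then show ?thesis by (auto simp: dist_commute)
      qed (use r in \<open>auto simp: I_def\<close>)
    qed
    ultimately have "y \<in> \<phi> ` I \<union> Some ` cball p e" using y closure_of_minimal by blast
    moreover have "\<phi> ` I \<subseteq> R" using b(1) by (auto simp: I_def R_def external_ray_def)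
    ultimately show False using e(2) ny by blast
  qed
  ultimately show ?thesis unfolding lands_on_def R_def[symmetric] by blast
qed

section \<open>Accessibility and logarithms\<close>

text \<open>The finite part of the ray together with its landing point meets \<open>X\<close> only in \<open>x\<close> and is closed,
  connected and unbounded; \<open>logarithm_off_unbounded_connected\<close> applies to it.\<close>

lemma accessible_imp_logarithm:
  assumes \<phi>: "exterior_riemann_map (- X) \<phi>" and lands: "lands_on (external_ray \<phi> \<theta>) x" and "x \<in> X"
  obtains l where "continuous_on (X - {x}) l" "\<And>z. z \<in> X - {x} \<Longrightarrow> exp (l z) = z - x"
proof -
  define R where "R = external_ray \<phi> \<theta>"
  define \<gamma> where "\<gamma> = (\<lambda>r::real. finite_chart (\<phi> (of_real r * cis \<theta>)))"
  have bij: "bij_betw \<phi> (ball 0 1) (insert None (Some ` (- X)))" and \<phi>0: "\<phi> 0 = None"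
    and hol: "sphere_holomorphic_on \<phi> (ball 0 1)"
    using \<phi> by (auto simp: exterior_riemann_map_def conformal_iso_def)
  have z: "of_real r * cis \<theta> \<in> ball 0 1" "of_real r * cis \<theta> \<noteq> 0" if "0 < r" "r < 1" for r
    using that by (auto simp: norm_mult)
  have \<gamma>: "\<gamma> r \<notin> X \<and> \<phi> (of_real r * cis \<theta>) = Some (\<gamma> r)" if "0 < r" "r < 1" for r
  proof -
    have "\<phi> (of_real r * cis \<theta>) \<noteq> None"
      using z[OF that] \<phi>0 bij by (metis bij_betw_inv_into_left centre_in_ball zero_less_one)
    then show ?thesis using bij_betwE[OF bij, rule_format, OF z(1)[OF that]] by (auto simp: \<gamma>_def finite_chart_def)
  qed
  have Req: "R = insert None (Some ` \<gamma> ` {0<..<1})"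
  proof (intro equalityI subsetI)
    fix y assume "y \<in> R"
    then obtain r where r: "0 \<le> r" "r < 1" "y = \<phi> (of_real r * cis \<theta>)" by (auto simp: R_def external_ray_def)
    then show "y \<in> insert None (Some ` \<gamma> ` {0<..<1})"
      using \<gamma>[of r] \<phi>0 by (cases "r = 0") auto
  next
    fix y assume "y \<in> insert None (Some ` \<gamma> ` {0<..<1})"
    then consider "y = None" | r where "0 < r" "r < 1" "y = Some (\<gamma> r)" by auto
    then show "y \<in> R"
    proof cases
      case 1 
      then have "y = \<phi> (of_real 0 * cis \<theta>)" using \<phi>0 by simp
      then show ?thesis unfolding R_def external_ray_def by (intro image_eqI) auto
    next
      case 2
      then have "y = \<phi> (of_real r * cis \<theta>)" using \<gamma> by simp
      then show ?thesis unfolding R_def external_ray_def using 2 by (intro image_eqI[OF _ CollectI]) auto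
    qed
  qed
  have "R \<subseteq> topspace riemann_sphere" by (auto simp: Req riemann_sphere_def)
  then have cl: "riemann_sphere closure_of R = insert (Some x) R"
    using lands closure_of_subset[of R riemann_sphere] unfolding lands_on_def R_def by blast
  define S where "S = insert x (\<gamma> ` {0<..<1})"
  have S: "z \<in> S \<longleftrightarrow> Some z \<in> riemann_sphere closure_of R" for z
    unfolding cl by (auto simp: Req S_def)
  have "closed S"
  proof -
    have "closedin euclidean {z \<in> topspace euclidean. Some z \<in> riemann_sphere closure_of R}"
      by (rule closedin_continuous_map_preimage[OF continuous_map_Some])
        (simp flip: riemann_sphere_def)
    then show ?thesis by (simp flip: S)
  qed
  have "connected (\<gamma> ` {0<..<1})"
  proof (rule connected_continuous_image)
    have an: "isCont (finite_chart \<circ> \<phi>) (of_real r * cis \<theta>)" if "r \<in> {0<..<1}" for r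
    proof -
      have "(finite_chart \<circ> \<phi>) analytic_on {of_real r * cis \<theta>}"
        using hol z[of r] \<gamma>[of r] that unfolding sphere_holomorphic_on_def by force
      then show ?thesis by (simp add: analytic_at_imp_isCont)
    qed
    have "isCont ((finite_chart \<circ> \<phi>) \<circ> (\<lambda>r. of_real r * cis \<theta>)) r" if "r \<in> {0<..<1}" for r :: real
      by (rule continuous_at_compose) (intro continuous_intros, rule an[OF that])
    then show "continuous_on {0<..<1} \<gamma>"
      by (intro continuous_at_imp_continuous_on) (auto simp: \<gamma>_def o_def)
  qed auto
  moreover have "x \<in> closure (\<gamma> ` {0<..<1})"
  proof (rule ccontr)
    assume x: "x \<notin> closure (\<gamma> ` {0<..<1})"
    define T where "T = Some ` (- closure (\<gamma> ` {0<..<1}))"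
    have "openin riemann_sphere T"
      by (simp add: T_def riemann_sphere_def open_Compl)
    moreover have "Some x \<in> T" using x by (simp add: T_def)
    moreover have "Some x \<in> riemann_sphere closure_of R" by (simp add: cl)
    ultimately have "\<exists>y. y \<in> R \<and> y \<in> T" unfolding in_closure_of by iprover
    moreover have "y \<notin> T" if "y \<in> R" for y
      using that closure_subset[of "\<gamma> ` {0<..<1}"] unfolding Req T_def by blast
    ultimately show False by blast
  qed
  ultimately have "connected S"
    by (intro connected_intermediate_closure[of "\<gamma> ` {0<..<1}" S])
      (auto simp: S_def intro: closure_subset[THEN subsetD])
  have "\<not> bounded S"
  proof
    assume "bounded S"
    then obtain B where B: "\<And>r. r \<in> {0<..<1} \<Longrightarrow> norm (\<gamma> r) \<le> B"
      unfolding bounded_iff S_def by blast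
    obtain c :: real where c: "c > 0" "((\<lambda>z. z * finite_chart (\<phi> z)) \<longlongrightarrow> of_real c) (at 0)"
      using \<phi> unfolding exterior_riemann_map_def by blast
    have ev: "\<forall>\<^sub>F r in at_right (0::real). r \<in> {0<..<1}"
      by (rule eventually_at_right_real) simp
    have "filterlim (\<lambda>r. of_real r * cis \<theta>) (at 0) (at_right (0::real))"
      unfolding filterlim_at
    proof
      have "((\<lambda>r. of_real r * cis \<theta>) \<longlongrightarrow> of_real 0 * cis \<theta>) (at_right (0::real))"
        by (intro tendsto_intros)
      then show "((\<lambda>r. of_real r * cis \<theta>) \<longlongrightarrow> 0) (at_right (0::real))" by simp
      show "\<forall>\<^sub>F r in at_right 0. of_real r * cis \<theta> \<in> UNIV \<and> of_real r * cis \<theta> \<noteq> 0"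
        using ev by eventually_elim auto
    qed
    from filterlim_compose[OF c(2) this]
    \<comment> \<open>The normalization at the origin forces the ray to be unbounded.\<close>
    have lim: "((\<lambda>r. of_real r * cis \<theta> * \<gamma> r) \<longlongrightarrow> of_real c) (at_right 0)" by (simp add: \<gamma>_def)
    have "((\<lambda>r. of_real r * cis \<theta> * \<gamma> r) \<longlongrightarrow> 0) (at_right 0)"
    proof (rule Lim_null_comparison)
      show "\<forall>\<^sub>F r in at_right 0. norm (of_real r * cis \<theta> * \<gamma> r) \<le> r * B"
        using ev by eventually_elim (use B in \<open>auto simp: norm_mult intro!: mult_left_mono\<close>)
      have "((\<lambda>r. r * B) \<longlongrightarrow> 0 * B) (at_right 0)" by (intro tendsto_intros)
      then show "((\<lambda>r. r * B) \<longlongrightarrow> 0) (at_right 0)" by simp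
    qed
    from tendsto_unique[OF trivial_limit_at_right_real lim this] show False using c(1) by simp
  qed
  then obtain l where l: "continuous_on (- S) l" "\<And>z. z \<notin> S \<Longrightarrow> exp (l z) = z - x"
    using logarithm_off_unbounded_connected[OF \<open>closed S\<close> \<open>connected S\<close>, of x] by (auto simp: S_def)
  have "X - {x} \<subseteq> - S" using \<gamma> by (auto simp: S_def)
  with l that[of l] show ?thesis by (metis ComplD continuous_on_subset subsetD)
qed

text \<open>After inversion at \<open>p\<close> the negative of the given logarithm is a logarithm of \<open>w\<close>. The second point
  \<open>q\<close> of \<open>K\<close> guarantees that the inverted domain is not the whole plane.\<close>

lemma logarithm_imp_accessible:
  assumes K: "compact K" "connected K" "p \<in> K" "q \<in> K" "q \<noteq> p"
    and U: "U \<in> components (- K)" "\<not> bounded U"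
    and l: "continuous_on (K - {p}) l" "\<And>z. z \<in> K - {p} \<Longrightarrow> exp (l z) = z - p"
  shows "accessible_from U p"
proof -
  have UK: "U \<subseteq> - K" using U(1) in_components_subset by blast
  then have pU: "p \<notin> U" using K(3) by auto
  define K' where "K' = inversion_at p ` (K - {p})"
  have memK': "w \<noteq> 0 \<and> p + inverse w \<in> K - {p}" if "w \<in> K'" for w
    using that mem_inversion_at_image[of p "K - {p}"] by (auto simp: K'_def inversion_at_def)
  have "continuous_on K' (\<lambda>w. - l (p + inverse w))"
    by (intro continuous_intros continuous_on_compose2[OF l(1)]) (use memK' in auto)
  moreover have "exp (- l (p + inverse w)) = w" if "w \<in> K'" for w
    using l(2)[of "p + inverse w"] memK'[OF that] by (simp add: exp_minus)
  ultimately obtain E where E: "closed E" "connected E" "\<not> bounded E" "0 \<in> E" "E \<inter> K' = {}"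
    using logarithm_imp_unbounded_connected_avoiding[of K' "\<lambda>w. - l (p + inverse w)"]
      closed_inversion_at_image[OF K(1)] unfolding K'_def by metis
  define V where "V = inverted_domain p U"
  have V: "open V" "simply_connected V" "E \<subseteq> V"
    using inverted_domain_properties[OF K(1,2,3) U] E unfolding V_def K'_def by blast+
  have aV: "inversion_at p q \<notin> V"
    using UK K(4,5) mem_inversion_at_image[OF pU, of "inversion_at p q"]
    by (auto simp: V_def inverted_domain_def inversion_at_def)
  have "0 \<in> V" using V(3) E(4) by blast
  obtain \<psi> f and c :: real where \<psi>: "\<psi> holomorphic_on ball 0 1" "continuous_on V f"
    "\<And>z. z \<in> ball 0 1 \<Longrightarrow> \<psi> z \<in> V \<and> f (\<psi> z) = z"
    "\<And>w. w \<in> V \<Longrightarrow> f w \<in> ball 0 1 \<and> \<psi> (f w) = w"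
    "\<psi> 0 = 0" "c > 0" "(\<psi> has_field_derivative of_real c) (at 0)"
    using normalized_riemann_map_exists[OF V(1,2) \<open>0 \<in> V\<close>] aV by (metis UNIV_I)
  obtain \<zeta> where \<zeta>: "norm \<zeta> = 1" "filterlim (\<lambda>r. \<psi> (of_real r * \<zeta>)) at_infinity (at_left (1::real))"
    using univalent_radial_limit_infinity_exists[OF \<psi>(1-4) V(1) aV V(3) E(1-3)] by blast
  define \<phi> where "\<phi> = outward_chart p \<circ> \<psi>"
  have ext: "exterior_riemann_map U \<phi>"
    unfolding \<phi>_def using exterior_riemann_map_from_inverted_domain[OF pU \<psi>(1) V_def \<psi>(3-7)] .
  have "\<zeta> \<noteq> 0" using \<zeta>(1) by auto
  then have cis: "cis (Arg \<zeta>) = \<zeta>" by (simp add: cis_Arg sgn_div_norm \<zeta>(1))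
  have "((\<lambda>r. p + inverse (\<psi> (of_real r * \<zeta>))) \<longlongrightarrow> p + 0) (at_left (1::real))"
    by (intro tendsto_intros filterlim_compose[OF tendsto_inverse_0 \<zeta>(2)])
  moreover have "\<forall>\<^sub>F r in at_left (1::real). \<psi> (of_real r * \<zeta>) \<noteq> 0"
    using \<zeta>(2) by (rule filterlim_at_infinity_imp_eventually_ne)
  then have "\<forall>\<^sub>F r in at_left (1::real). p + inverse (\<psi> (of_real r * \<zeta>)) = finite_chart (\<phi> (of_real r * \<zeta>))"
    by eventually_elim (simp add: \<phi>_def outward_chart_def finite_chart_def)
  ultimately have "((\<lambda>r. finite_chart (\<phi> (of_real r * \<zeta>))) \<longlongrightarrow> p) (at_left (1::real))"
    using Lim_transform_eventually by force
  then have "lands_on (external_ray \<phi> (Arg \<zeta>)) p"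
    using external_ray_lands[OF ext pU, of "Arg \<zeta>"] cis by simp
  with ext pU show ?thesis unfolding accessible_from_def by blast
qed

text \<open>Injectivity of each \<open>h (_, t)\<close> keeps \<open>h (z, t) - h (x, t)\<close> away from zero, so the homotopy lifting
  property of \<open>exp\<close> extends the logarithm given at time 0. Continuity of the inverse homeomorphism
  turns it into a function on the image at time \<open>t\<close>.\<close>

lemma isotopy_transports_logarithm:
  assumes iso: "isotopy_on S h" and h0: "\<And>z. z \<in> S \<Longrightarrow> h (z, 0) = z" and x: "x \<in> S"
    and l: "continuous_on (S - {x}) l" "\<And>z. z \<in> S - {x} \<Longrightarrow> exp (l z) = z - x"
    and t: "t \<in> {0..1}"
  obtains m where "continuous_on ((\<lambda>z. h (z, t)) ` S - {h (x, t)}) m"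
    "\<And>w. w \<in> (\<lambda>z. h (z, t)) ` S - {h (x, t)} \<Longrightarrow> exp (m w) = w - h (x, t)"
proof -
  have inj: "inj_on (\<lambda>z. h (z, s)) S" if "s \<in> {0..1}" for s
  proof -
    obtain g where "homeomorphism S ((\<lambda>z. h (z, s)) ` S) (\<lambda>z. h (z, s)) g"
      using iso \<open>s \<in> {0..1}\<close> unfolding isotopy_on_def by blast
    then show ?thesis by (intro inj_on_inverseI[of _ g]) (simp add: homeomorphism_def)
  qed
  have conth: "continuous_on (S \<times> {0..1}) h" using iso by (simp add: isotopy_on_def)
  have H1: "continuous_on ((S - {x}) \<times> {0..1}) (\<lambda>y. h y - h (x, snd y))"
    using x by (intro continuous_intros continuous_on_compose2[OF conth] continuous_on_subset[OF conth]) auto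
  have H2: "(\<lambda>y. h y - h (x, snd y)) \<in> (S - {x}) \<times> {0..1} \<rightarrow> - {0}"
    using inj x by (fastforce simp: inj_on_def)
  have H3: "h (z, 0) - h (x, snd (z, 0::real)) = exp (l z)" if "z \<in> S - {x}" for z
    using that l(2) h0 x by simp
  obtain k where k: "continuous_on ((S - {x}) \<times> {0..1}) k" "k \<in> (S - {x}) \<times> {0..1} \<rightarrow> UNIV"
    "\<And>z. z \<in> S - {x} \<Longrightarrow> k (z, 0) = l z"
    "\<And>y. y \<in> (S - {x}) \<times> {0..1} \<Longrightarrow> h y - h (x, snd y) = exp (k y)"
    by (rule covering_space_lift_homotopy_alt[OF covering_space_exp_punctured_plane H1 H2 H3 l(1)]) blast+
  obtain g where g: "homeomorphism S ((\<lambda>z. h (z, t)) ` S) (\<lambda>z. h (z, t)) g"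
    using iso t unfolding isotopy_on_def by blast
  have gS: "g w \<in> S - {x} \<and> h (g w, t) = w" if "w \<in> (\<lambda>z. h (z, t)) ` S - {h (x, t)}" for w
    using that g unfolding homeomorphism_def by auto
  show ?thesis
  proof
    have "continuous_on ((\<lambda>z. h (z, t)) ` S - {h (x, t)}) g"
      using g by (meson Diff_subset continuous_on_subset homeomorphism_def)
    then show "continuous_on ((\<lambda>z. h (z, t)) ` S - {h (x, t)}) (\<lambda>w. k (g w, t))"
      by (intro continuous_on_compose2[OF k(1)] continuous_intros) (use gS t in auto)
    show "exp (k (g w, t)) = w - h (x, t)" if "w \<in> (\<lambda>z. h (z, t)) ` S - {h (x, t)}" for w
      using k(4)[of "(g w, t)"] gS[OF that] t by simp
  qed
qed

lemma frontier_not_singleton: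
  fixes X :: "complex set"
  assumes "compact X" "nondegenerate X" "x \<in> frontier X"
  obtains y where "y \<in> frontier X" "y \<noteq> x"
proof -
  obtain a where a: "a \<in> X" "a \<noteq> x" using assms(2) unfolding nondegenerate_def by metis
  have "connected (- {x})" by (simp add: connected_punctured_universe)
  moreover have "- {x} - X \<noteq> {}"
  proof
    assume "- {x} - X = {}"
    then have "UNIV \<subseteq> insert x X" by auto
    then have "bounded (UNIV :: complex set)" 
      using bounded_subset[of "insert x X" UNIV] compact_imp_bounded[OF assms(1)] by simp
    then show False by simp
  qed
  ultimately have "- {x} \<inter> frontier X \<noteq> {}" using a by (intro connected_Int_frontier) auto
  then show ?thesis using that by auto
qed

theorem theorem3p2:
  fixes X :: "complex set"
    and h :: "complex \<times> real \<Rightarrow> complex"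
    and U :: "real \<Rightarrow> complex set"
    and x :: complex
  assumes "continuum X" "nondegenerate X" "non_separating X"
    and "isotopy_on (frontier X) h"
    and "\<And>z. z \<in> frontier X \<Longrightarrow> h (z, 0) = z"
    and "\<And>t. t \<in> {0..1} \<Longrightarrow>
           U t \<in> components (- ((\<lambda>z. h (z, t)) ` frontier X)) \<and> \<not> bounded (U t)"
    and "x \<in> frontier X"
    and "accessible_from (- X) x"
  shows "\<forall>t\<in>{0..1}. accessible_from (U t) (h (x, t))"
proof
  fix t :: real assume t: "t \<in> {0..1}"
  have X: "compact X" "connected X" "connected (- X)"
    using assms(1,3) by (auto simp: continuum_def non_separating_def)
  have FX: "frontier X \<subseteq> X" using X(1) by (simp add: compact_imp_closed frontier_subset_closed)
  obtain \<phi> \<theta> where "exterior_riemann_map (- X) \<phi>" "lands_on (external_ray \<phi> \<theta>) x"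
    using assms(8) by (auto simp: accessible_from_def)
  then obtain l where l: "continuous_on (X - {x}) l" "\<And>z. z \<in> X - {x} \<Longrightarrow> exp (l z) = z - x"
    using accessible_imp_logarithm FX assms(7) by (metis subsetD)
  have l': "continuous_on (frontier X - {x}) l" "\<And>z. z \<in> frontier X - {x} \<Longrightarrow> exp (l z) = z - x"
    using continuous_on_subset[OF l(1)] l(2) FX by (blast, blast)
  define K where "K = (\<lambda>z. h (z, t)) ` frontier X"
  obtain m where m: "continuous_on (K - {h (x, t)}) m" "\<And>w. w \<in> K - {h (x, t)} \<Longrightarrow> exp (m w) = w - h (x, t)"
    using isotopy_transports_logarithm[OF assms(4,5,7) l' t] unfolding K_def by metis
  obtain g where g: "homeomorphism (frontier X) K (\<lambda>z. h (z, t)) g"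
    using assms(4) t unfolding isotopy_on_def K_def by blast
  have cont: "continuous_on (frontier X) (\<lambda>z. h (z, t))" using g by (simp add: homeomorphism_def)
  have "compact K" unfolding K_def
    using cont X(1) by (intro compact_continuous_image compact_frontier)
  moreover have "connected K" unfolding K_def
    using cont X(2,3) by (intro connected_continuous_image connected_frontier_simple)
  moreover obtain y where y: "y \<in> frontier X" "y \<noteq> x"
    using frontier_not_singleton[OF X(1) assms(2,7)] by blast
  have "h (y, t) \<noteq> h (x, t)" using g y assms(7) unfolding homeomorphism_def by metis
  moreover have "h (x, t) \<in> K" "h (y, t) \<in> K" using y assms(7) by (auto simp: K_def)
  ultimately show "accessible_from (U t) (h (x, t))"
    using logarithm_imp_accessible[of K "h (x, t)" "h (y, t)" "U t" m] m assms(6)[OF t]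
    unfolding K_def by blast
qed

end
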